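(* Let $z:\mathbb Z^2\to\hat{\mathbb C}$ be a polygon recutting lattice map, and let $w:\mathbb Z^2\to\hat{\mathbb C}$ be an integrable cross-ratio map such that $z,w$ is a Bäcklund pair. Consider the square lattice with face weights $$a_{i,j}=\begin{cases} z_{\frac{i+j+[i+j]_2}{2},\frac{-(i+j)+[i+j]_2}{2}} & \text{if }[i-j]_4\in\{0,3\},\\ w_{\frac{i+j+[i+j]_2}{2},\frac{-(i+j)+[i+j]_2}{2}} & \text{if }[i-j]_4\in\{1,2\}\end{cases}$$ (so the weights form a subset of $(z_{i,j})_{i+j\in\{0,1\}},(w_{i,j})_{i+j\in\{0,1\}}$). Then, for all $(i,j)\in\mathbb Z^2$ such that $i+j\ge1$, $z_{i,j}$ is equal to the ratio function of oriented dimers of an Aztec diamond: $$z_{i,j}=Y\bigl(A_{i+j-1}(u,v),a\bigr),$$ where $(u,v)\in\mathbb Z^2$ is any face with $u+v=i-j$ and with $[u-v]_4\in\{0,3\}$ if $[i+j]_4\in\{0,1\}$, respectively $[u-v]_4\in\{1,2\}$ if $[i+j]_4\in\{2,3\}$.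
   Context: $\hat{\mathbb C}=\mathbb C\cup\{\infty\}$ is identified with $\mathbb{CP}^1$; $[n]_q\in\{0,\dots,q-1\}$ is the residue of $n$ modulo $q$; $\operatorname{cr}(a,b,c,d)=\frac{(a-b)(c-d)}{(b-c)(d-a)}$. Polygon recutting lattice map: points $\tilde z_{i,j}$ ($i+j$ even) in the complex plane such that $\tilde z_{i,j}$ is the reflection of $\tilde z_{i,j-2}$ about the perpendicular bisector of the segment $[\tilde z_{i-1,j-1}\tilde z_{i+1,j-1}]$ for all $i,j$ with $i+j$ even; $z_{i,j}=\tilde z_{i-j,i+j}$ is also called a polygon recutting lattice map. Such a $z$ is an integrable cross-ratio map, i.e. $\operatorname{cr}(z_{i,j},z_{i+1,j},z_{i+1,j+1},z_{i,j+1})=\alpha_i/\beta_j$, with edge-labels $\alpha_i=|\tilde z_{2i,0}-\tilde z_{2i+1,1}|^2$ and $\beta_j=|\tilde z_{-2j-1,1}-\tilde z_{-2j,0}|^2$. A Bäcklund pair $z,w$ is a pair of integrable cross-ratio maps with the same edge-labels $\alpha,\beta:\mathbb Z\to\mathbb C\setminus\{0\}$ such that for some $\gamma\in\mathbb C\setminus\{0\}$ and all $(i,j)$, $\operatorname{cr}(z_{i,j},z_{i+1,j},w_{i+1,j},w_{i,j})=\alpha_i/\gamma$ and $\operatorname{cr}(z_{i,j},z_{i,j+1},w_{i,j+1},w_{i,j})=\beta_j/\gamma$. Ratio function of oriented dimers. Consider the square lattice whose faces are the unit squares centered at the points of $\mathbb Z^2$, face $(i,j)$ carrying the weight $a_{i,j}$.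 For $k\ge1$, the Aztec diamond $A_k(i,j)$ is the subgraph formed by the vertices and edges of its internal faces, which are the faces $(i',j')$ with $|i'-i|+|j'-j|<k$; its open faces are the $(i',j')$ with $|i'-i|+|j'-j|=k$; $F$ is the set of all internal and open faces. The graph is bipartite. A Kasteleyn orientation is a skew-symmetric function $\varphi$ from directed edges to $\{-1,1\}$ such that for every internal face $f$, $\prod_{wb\in\partial f}\varphi_{(w,b)}=-1$ (product over the four boundary edges, each directed from white to black). An oriented dimer configuration $\vec{M}$ is a set of directed edges whose undirected version is a perfect matching (each matched edge carrying exactly one direction). Its weight is $\prod_{\vec e\in\vec M}\varphi_{\vec e}\,a_{f(\vec e)}$, where $f(\vec e)\in F$ is the face to the right of $\vec e$. $Z(A,a,\varphi)$ is the sum of the weights of all oriented dimer configurations of $A$, and $Y(A,a)=\bigl(\prod_{f\in F}a_f\bigr)\frac{Z(A,a^{-1},\varphi)}{Z(A,a,\varphi)}$, where $a^{-1}$ denotes the inverse face weights; this does not depend on $\varphi$. For size $0$, $Y(A_0(i,j),a)=a_{i,j}$. $Y$ is regarded as a rational function of the face weights. Standing assumption: the data are generic, so that all expressions are well defined. *)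

theory Defs
  imports "HOL-Analysis.Analysis"
begin

section \<open>Cross-ratios on the Riemann sphere\<close>

datatype riemann_sphere = Fin complex | Infty

fun homog :: "riemann_sphere \<Rightarrow> complex \<times> complex" where
  "homog (Fin x) = (x, 1)"
| "homog Infty = (1, 0)"

text \<open>The homogeneous difference: it equals \<open>x - y\<close> on finite points.\<close>

definition bracket :: "riemann_sphere \<Rightarrow> riemann_sphere \<Rightarrow> complex" where
  "bracket p q = fst (homog p) * snd (homog q) - snd (homog p) * fst (homog q)"

text \<open>
  This is \<open>(a - b) (c - d) / ((b - c) (d - a))\<close>, where \<open>\<infinity>\<close> is allowed among the points.
  Each point occurs once in the numerator and once in the denominator, so the choice of
  homogeneous coordinates is irrelevant.  In the indeterminate case \<open>0/0\<close> the value
  is the arbitrary \<open>Infty\<close>; hence an equation \<open>cross_ratio a b c d = Fin l\<close> entails that the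
  cross-ratio is well defined, and for \<open>l \<noteq> 0\<close> that cyclically adjacent points are distinct.
\<close>

definition cross_ratio ::
  "riemann_sphere \<Rightarrow> riemann_sphere \<Rightarrow> riemann_sphere \<Rightarrow> riemann_sphere \<Rightarrow> riemann_sphere" where
  "cross_ratio a b c d =
     (if bracket b c * bracket d a = 0 then Infty
      else Fin ((bracket a b * bracket c d) / (bracket b c * bracket d a)))"


section \<open>Integrable cross-ratio maps and polygon recutting\<close>

definition integrable_cross_ratio_map ::
  "(int \<Rightarrow> complex) \<Rightarrow> (int \<Rightarrow> complex) \<Rightarrow> (int \<Rightarrow> int \<Rightarrow> riemann_sphere) \<Rightarrow> bool" where
  "integrable_cross_ratio_map \<alpha> \<beta> z \<longleftrightarrow>
     (\<forall>i. \<alpha> i \<noteq> 0) \<and> (\<forall>j. \<beta> j \<noteq> 0) \<and>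
     (\<forall>i j. cross_ratio (z i j) (z (i+1) j) (z (i+1) (j+1)) (z i (j+1)) = Fin (\<alpha> i / \<beta> j))"

definition baecklund_pair ::
  "(int \<Rightarrow> int \<Rightarrow> riemann_sphere) \<Rightarrow> (int \<Rightarrow> int \<Rightarrow> riemann_sphere) \<Rightarrow> bool" where
  "baecklund_pair z w \<longleftrightarrow>
     (\<exists>\<alpha> \<beta> \<gamma>. \<gamma> \<noteq> 0 \<and>
        integrable_cross_ratio_map \<alpha> \<beta> z \<and> integrable_cross_ratio_map \<alpha> \<beta> w \<and>
        (\<forall>i j. cross_ratio (z i j) (z (i+1) j) (w (i+1) j) (w i j) = Fin (\<alpha> i / \<gamma>)) \<and>
        (\<forall>i j. cross_ratio (z i j) (z i (j+1)) (w i (j+1)) (w i j) = Fin (\<beta> j / \<gamma>)))"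

text \<open>
  Reflection of \<open>x\<close> about the perpendicular bisector of the segment \<open>[p q]\<close>, that is, about the
  line through \<open>midpoint p q\<close> with normal vector \<open>q - p\<close>; meaningful for \<open>p \<noteq> q\<close>.
\<close>

definition reflect_bisector :: "complex \<Rightarrow> complex \<Rightarrow> complex \<Rightarrow> complex" where
  "reflect_bisector p q x =
     x - (2 * ((x - midpoint p q) \<bullet> (q - p)) / (norm (q - p))\<^sup>2) *\<^sub>R (q - p)"

text \<open>Only the values \<open>t i j\<close> with \<open>i + j\<close> even matter.\<close>

definition polygon_recutting :: "(int \<Rightarrow> int \<Rightarrow> complex) \<Rightarrow> bool" where
  "polygon_recutting t \<longleftrightarrow>
     (\<forall>i j. even (i + j) \<longrightarrow>
        t (i-1) (j-1) \<noteq> t (i+1) (j-1) \<and>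
        t i j = reflect_bisector (t (i-1) (j-1)) (t (i+1) (j-1)) (t i (j-2)))"

definition polygon_recutting_lattice_map :: "(int \<Rightarrow> int \<Rightarrow> riemann_sphere) \<Rightarrow> bool" where
  "polygon_recutting_lattice_map z \<longleftrightarrow>
     (\<exists>t. polygon_recutting t \<and> (\<forall>i j. z i j = Fin (t (i-j) (i+j))))"


section \<open>Oriented dimers on Aztec diamonds\<close>

text \<open>
  The face \<open>(i, j)\<close> is the unit square centred at \<open>(i, j)\<close>.  The pair \<open>(p, q)\<close>, used as a
  vertex, stands for the point \<open>(p - 1/2, q - 1/2)\<close>, the lower left corner of the face \<open>(p, q)\<close>.
  Edges are handled through their two directed versions (darts), pairs of adjacent vertices.
\<close>

type_synonym face = "int \<times> int"
type_synonym vertex = "int \<times> int"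
type_synonym dart = "vertex \<times> vertex"

fun corners :: "face \<Rightarrow> vertex set" where
  "corners (i, j) = {(i, j), (i+1, j), (i, j+1), (i+1, j+1)}"

fun adjacent :: "vertex \<Rightarrow> vertex \<Rightarrow> bool" where
  "adjacent (p, q) (r, s) \<longleftrightarrow> \<bar>p - r\<bar> + \<bar>q - s\<bar> = 1"

definition face_darts :: "face \<Rightarrow> dart set" where
  "face_darts f = {(x, y). x \<in> corners f \<and> y \<in> corners f \<and> adjacent x y}"

text \<open>For the four directions east, west, north and south, in this order.\<close>

fun right_face :: "dart \<Rightarrow> face" where
  "right_face ((p, q), (r, s)) =
     (if r = p + 1 then (p, q - 1)
      else if r = p - 1 then (p - 1, q)
      else if s = q + 1 then (p, q)
      else (p - 1, q - 1))"

text \<open>The other vertices are black; exchanging the two colours changes none of the notions below.\<close>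

fun white :: "vertex \<Rightarrow> bool" where
  "white (p, q) \<longleftrightarrow> even (p + q)"

fun face_dist :: "face \<Rightarrow> face \<Rightarrow> int" where
  "face_dist (i, j) (i', j') = \<bar>i' - i\<bar> + \<bar>j' - j\<bar>"

text \<open>
  In the following, \<open>k\<close> is the size and \<open>c\<close> the central face of the Aztec diamond \<open>A_k(c)\<close>.
\<close>

definition internal_faces :: "nat \<Rightarrow> face \<Rightarrow> face set" where
  "internal_faces k c = {f. face_dist c f < int k}"

definition aztec_faces :: "nat \<Rightarrow> face \<Rightarrow> face set" where
  "aztec_faces k c = {f. face_dist c f \<le> int k}"

definition aztec_vertices :: "nat \<Rightarrow> face \<Rightarrow> vertex set" where
  "aztec_vertices k c = (\<Union>f\<in>internal_faces k c. corners f)"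

definition aztec_darts :: "nat \<Rightarrow> face \<Rightarrow> dart set" where
  "aztec_darts k c = (\<Union>f\<in>internal_faces k c. face_darts f)"

definition kasteleyn_orientation :: "nat \<Rightarrow> face \<Rightarrow> (dart \<Rightarrow> complex) \<Rightarrow> bool" where
  "kasteleyn_orientation k c \<phi> \<longleftrightarrow>
     (\<forall>(x, y)\<in>aztec_darts k c. \<phi> (x, y) \<in> {-1, 1} \<and> \<phi> (y, x) = - \<phi> (x, y)) \<and>
     (\<forall>f\<in>internal_faces k c. (\<Prod>e\<in>{(x, y) \<in> face_darts f. white x}. \<phi> e) = -1)"

text \<open>
  Every vertex is an end of exactly one dart in \<open>M\<close>: so no edge is present in both directions,
  and the undirected edges form a perfect matching.
\<close>

definition oriented_dimers :: "nat \<Rightarrow> face \<Rightarrow> dart set set" where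
  "oriented_dimers k c =
     {M. M \<subseteq> aztec_darts k c \<and>
         (\<forall>x\<in>aztec_vertices k c. \<exists>!e. e \<in> M \<and> (fst e = x \<or> snd e = x))}"

definition dimer_Z :: "nat \<Rightarrow> face \<Rightarrow> (dart \<Rightarrow> complex) \<Rightarrow> (face \<Rightarrow> complex) \<Rightarrow> complex" where
  "dimer_Z k c \<phi> a = (\<Sum>M\<in>oriented_dimers k c. \<Prod>e\<in>M. \<phi> e * a (right_face e))"

text \<open>
  For \<open>k = 0\<close> the graph is empty, its only configuration is the empty one, and
  \<open>aztec_faces 0 c = {c}\<close>, so that the formula gives \<open>a c\<close>, as it should.
  The value is meaningful if \<open>a\<close> does not vanish on \<open>aztec_faces k c\<close> and
  \<open>dimer_Z k c \<phi> a \<noteq> 0\<close>; it does not depend on the Kasteleyn orientation \<open>\<phi>\<close>.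
\<close>

definition ratio_function ::
  "nat \<Rightarrow> face \<Rightarrow> (dart \<Rightarrow> complex) \<Rightarrow> (face \<Rightarrow> complex) \<Rightarrow> complex" where
  "ratio_function k c \<phi> a =
     (\<Prod>f\<in>aztec_faces k c. a f) * (dimer_Z k c \<phi> (\<lambda>f. inverse (a f)) / dimer_Z k c \<phi> a)"


section \<open>The face weights\<close>

text \<open>Both divisions by 2 are exact.\<close>

fun face_weight ::
  "(int \<Rightarrow> int \<Rightarrow> riemann_sphere) \<Rightarrow> (int \<Rightarrow> int \<Rightarrow> riemann_sphere) \<Rightarrow> face \<Rightarrow> riemann_sphere" where
  "face_weight z w (i, j) =
     (if (i - j) mod 4 \<in> {0, 3}
      then z ((i + j + (i + j) mod 2) div 2) ((- (i + j) + (i + j) mod 2) div 2)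
      else w ((i + j + (i + j) mod 2) div 2) ((- (i + j) + (i + j) mod 2) div 2))"

end

(*
  Lift the points to nonzero vectors of C^2 and write [p, q] for the determinant.  For a pair L, M
  with [M, L] = 1 or -1, the affine coordinate [p, M] / [p, L] turns a lattice of points into face
  weights; L = (-1, 0) and L = (0, 1) give the weights a and their inverses.  The claim is that
  (product over the faces f of [X_f, L]) * Z(A_k, chart L M X) = C * [Y, L], where C does not
  depend on L and Y is the point of the dSKP solution above the centre: comparing the two values of
  L gives the ratio function.

  This is proved by induction on k.  Every edge of A_(k+1) lies in exactly one of the (k+1)^2 faces
  ("cells") whose distance to the centre has the parity of k, so that an oriented dimer
  configuration is a choice, for each cell, of the corners covered inside it.  A vertex of A_(k+1)
  lies in two cells if it belongs to A_k, and in one cell otherwise; hence taking complements of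
  the corner sets yields configurations of A_k on the same cells.  The dSKP equation is exactly what
  identifies the complemented cell weights, up to a gauge at the vertices, with those obtained by
  replacing the point at the centre of the cell by the new one.

  The induction step divides by [p, L] for all points p that occur, which may vanish for the two
  values of L above; it is therefore carried out for generic L, followed by a limit.
*)

theory Submission
  imports Defs
begin

section \<open>Exact covers assembled from cells\<close>

text \<open>The two directions of an edge have opposite signs, and the faces on their right are the
  two sides of the edge; so an edge contributes a signed difference of weights. In a chart such a
  difference is \<open>wedge p q\<close>, divided by one factor \<open>wedge p L\<close> per point
  and multiplied by the constant \<open>wedge M L\<close>. This is why the powers of
  \<open>wedge p L\<close> can be counted and why the constant C is free of L. The dSKP equation
  comes from a cube formed by a quad of one map and the corresponding quad of the other. The three
  cross-ratios at a vertex v have the values \<alpha>/\<beta>, \<alpha>/\<gamma> and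
  \<beta>/\<gamma>; combining them removes the labels and v itself and leaves a relation between six
  points. These are the vertices of an octahedron once the two maps are interleaved, with period 4,
  into a function of three integers of even sum in which z(i,j) has level i + j. The face weights
  are the levels 0 and 1, and a diamond of size k reaches level k + 1, hence the size i + j - 1. At
  higher levels a point may be 0 or, for w, infinite. These are exactly the zeros of
  \<open>wedge p L\<close> for the two special values of L, which is why a limit is taken.\<close>

definition matchings :: "('v \<times> 'v) set \<Rightarrow> 'v set \<Rightarrow> ('v \<times> 'v) set set" where
  "matchings E V =
     {M. M \<subseteq> E \<and> (\<forall>x. card {e \<in> M. fst e = x \<or> snd e = x} = of_bool (x \<in> V))}"

definition matching_sum ::
  "('v \<times> 'v) set \<Rightarrow> ('v \<times> 'v \<Rightarrow> complex) \<Rightarrow> 'v set \<Rightarrow> complex" where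
  "matching_sum E wt V = (\<Sum>M\<in>matchings E V. \<Prod>e\<in>M. wt e)"

lemma nonempty_iff_card_of_bool: "finite A \<Longrightarrow> card A = of_bool b \<Longrightarrow> A \<noteq> {} \<longleftrightarrow> b"
  by (cases b) auto

lemma finite_matchings: "finite E \<Longrightarrow> finite (matchings E V)"
  by (rule finite_subset[of _ "Pow E"]) (auto simp: matchings_def)

lemma matching_ends:
  assumes "finite E" "M \<in> matchings E V" "e \<in> M"
  shows "fst e \<in> V" "snd e \<in> V"
proof -
  have fin: "finite M"
    using assms by (auto simp: matchings_def intro: finite_subset)
  have pos: "card {e' \<in> M. fst e' = x \<or> snd e' = x} \<noteq> 0" if "x = fst e \<or> x = snd e" for x
  proof -
    have "e \<in> {e' \<in> M. fst e' = x \<or> snd e' = x}" using assms(3) that by auto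
    moreover have "finite {e' \<in> M. fst e' = x \<or> snd e' = x}" using fin by simp
    ultimately show ?thesis unfolding card_eq_0_iff by blast
  qed
  show "fst e \<in> V" "snd e \<in> V"
    using pos[of "fst e"] pos[of "snd e"] assms(2) by (auto simp: matchings_def split: if_splits)
qed

text \<open>For \<open>\<sigma>\<close> in this set, \<open>\<sigma> c\<close> is the set of corners that are covered by edges of the cell \<open>c\<close>.\<close>

definition cell_covers :: "'c set \<Rightarrow> ('c \<Rightarrow> 'v set) \<Rightarrow> 'v set \<Rightarrow> ('c \<Rightarrow> 'v set) set" where
  "cell_covers C K V =
     {\<sigma> \<in> PiE C (\<lambda>c. Pow (K c)). \<forall>x. card {c \<in> C. x \<in> \<sigma> c} = of_bool (x \<in> V)}"

lemma card_incident_UN: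
  assumes "finite C" "\<And>c. c \<in> C \<Longrightarrow> finite (g c)" "\<And>c. c \<in> C \<Longrightarrow> g c \<subseteq> E c"
    and "disjoint_family_on E C"
  shows "card {e \<in> \<Union>c\<in>C. g c. Q e} = (\<Sum>c\<in>C. card {e \<in> g c. Q e})"
proof -
  have "{e \<in> \<Union>c\<in>C. g c. Q e} = (\<Union>c\<in>C. {e \<in> g c. Q e})" by auto
  moreover have "card \<dots> = (\<Sum>c\<in>C. card {e \<in> g c. Q e})"
    using assms by (intro card_UN_disjoint) (auto simp: disjoint_family_on_def, blast)
  ultimately show ?thesis by simp
qed

lemma sum_of_bool_card: "finite C \<Longrightarrow> (\<Sum>c\<in>C. of_bool (Q c)) = card {c \<in> C. Q c}"
  by (simp add: Int_def)

text \<open>In \<open>matchings\<close> incidences are counted as numbers because counts add up over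
  disjoint sets of edges. Once the corners covered inside each cell are prescribed, the choices in
  different cells are independent, so the sum factors over the cells.\<close>

lemma matching_sum_cells:
  assumes finC: "finite C" and finE: "\<And>c. c \<in> C \<Longrightarrow> finite (E c)"
    and disj: "disjoint_family_on E C"
    and finK: "\<And>c. c \<in> C \<Longrightarrow> finite (K c)"
    and ends: "\<And>c e. c \<in> C \<Longrightarrow> e \<in> E c \<Longrightarrow> fst e \<in> K c \<and> snd e \<in> K c"
  shows "matching_sum (\<Union>c\<in>C. E c) wt V =
    (\<Sum>\<sigma>\<in>cell_covers C K V. \<Prod>c\<in>C. matching_sum (E c) wt (\<sigma> c))"
proof -
  define T where "T = (SIGMA \<sigma>:cell_covers C K V. PiE C (\<lambda>c. matchings (E c) (\<sigma> c)))"
  \<comment> \<open>The inverse of uniting local configurations. The covered corners are recorded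
    too, since they index the outer sum.\<close>
  define to where "to = (\<lambda>M. (\<lambda>c\<in>C. {x. \<exists>e\<in>M \<inter> E c. fst e = x \<or> snd e = x}, \<lambda>c\<in>C. M \<inter> E c))"
  have fincov: "finite (cell_covers C K V)"
    using finC finK by (intro finite_subset[of "cell_covers C K V" "PiE C (\<lambda>c. Pow (K c))"] finite_PiE)
      (auto simp: cell_covers_def)
  have "(\<Sum>\<sigma>\<in>cell_covers C K V. \<Prod>c\<in>C. matching_sum (E c) wt (\<sigma> c)) =
    (\<Sum>\<sigma>\<in>cell_covers C K V. \<Sum>g\<in>PiE C (\<lambda>c. matchings (E c) (\<sigma> c)). \<Prod>c\<in>C. \<Prod>e\<in>g c. wt e)"
    unfolding matching_sum_def using finC finE
    by (intro sum.cong refl prod_sum_PiE) (auto intro: finite_matchings)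
  also have "\<dots> = (\<Sum>(\<sigma>, g)\<in>T. \<Prod>c\<in>C. \<Prod>e\<in>g c. wt e)"
    unfolding T_def using finC finE fincov
    by (intro sum.Sigma) (auto intro!: finite_PiE finite_matchings)
  also have "\<dots> = (\<Sum>M\<in>matchings (\<Union>c\<in>C. E c) V. \<Prod>e\<in>M. wt e)"
  proof (rule sum.reindex_bij_witness[where i = to and j = "\<lambda>(\<sigma>, g). \<Union>c\<in>C. g c"])
    fix sg assume "sg \<in> T"
    then obtain \<sigma> g where sg: "sg = (\<sigma>, g)" and \<sigma>: "\<sigma> \<in> cell_covers C K V"
      and g: "g \<in> PiE C (\<lambda>c. matchings (E c) (\<sigma> c))"
      by (auto simp: T_def)
    have gE: "g c \<subseteq> E c" if "c \<in> C" for c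
      using g that by (auto simp: PiE_iff matchings_def)
    have fing: "finite (g c)" if "c \<in> C" for c
      using gE[OF that] finE[OF that] by (rule finite_subset)
    have restr: "(\<Union>c\<in>C. g c) \<inter> E c = g c" if "c \<in> C" for c
      using gE that disj by (fastforce simp: disjoint_family_on_def)
    have card_g: "card {e \<in> g c. fst e = x \<or> snd e = x} = of_bool (x \<in> \<sigma> c)" if "c \<in> C" for c x
      using g that by (auto simp: PiE_iff matchings_def)
    have \<sigma>_eq: "{x. \<exists>e\<in>g c. fst e = x \<or> snd e = x} = \<sigma> c" if "c \<in> C" for c
    proof -
      have "x \<in> \<sigma> c \<longleftrightarrow> {e \<in> g c. fst e = x \<or> snd e = x} \<noteq> {}" for x
        using nonempty_iff_card_of_bool[OF _ card_g[OF that, of x]] fing[OF that] by simp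
      then show ?thesis by blast
    qed
    show "to (case sg of (\<sigma>, g) \<Rightarrow> \<Union>c\<in>C. g c) = sg"
      using \<sigma> g by (auto simp: to_def sg restr \<sigma>_eq cell_covers_def PiE_iff extensional_def fun_eq_iff)
    show "(case sg of (\<sigma>, g) \<Rightarrow> \<Union>c\<in>C. g c) \<in> matchings (\<Union>c\<in>C. E c) V"
    proof -
      have "card {e \<in> \<Union>c\<in>C. g c. fst e = x \<or> snd e = x} = of_bool (x \<in> V)" for x
        using card_incident_UN[OF finC fing gE disj, of "\<lambda>e. fst e = x \<or> snd e = x"] \<sigma>
        by (simp add: card_g sum_of_bool_card[OF finC] cell_covers_def del: sum_of_bool_eq)
      then show ?thesis using gE unfolding sg matchings_def prod.case by blast
    qed
    have "(\<Prod>e\<in>(\<Union>c\<in>C. g c). wt e) = (\<Prod>c\<in>C. \<Prod>e\<in>g c. wt e)"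
      using finC fing gE disj
      by (intro prod.UNION_disjoint) (auto simp: disjoint_family_on_def, blast)
    then show "(\<Prod>e\<in>(case sg of (\<sigma>, g) \<Rightarrow> \<Union>c\<in>C. g c). wt e) =
        (case sg of (\<sigma>, g) \<Rightarrow> \<Prod>c\<in>C. \<Prod>e\<in>g c. wt e)"
      by (simp add: sg)
  next
    fix M assume M: "M \<in> matchings (\<Union>c\<in>C. E c) V"
    have cM: "card {e \<in> M. fst e = x \<or> snd e = x} = of_bool (x \<in> V)" for x
      using M by (auto simp: matchings_def)
    have UN: "(\<Union>c\<in>C. M \<inter> E c) = M" using M by (auto simp: matchings_def)
    then show "(case to M of (\<sigma>, g) \<Rightarrow> \<Union>c\<in>C. g c) = M" by (simp add: to_def)
    have "(\<Sum>c\<in>C. card {e \<in> M \<inter> E c. Q e}) = card {e \<in> M. Q e}" for Q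
      using card_incident_UN[of C "\<lambda>c. M \<inter> E c" E Q] finC finE disj by (simp only: UN) simp
    then have sum: "(\<Sum>c\<in>C. card {e \<in> M \<inter> E c. fst e = x \<or> snd e = x}) = of_bool (x \<in> V)" for x
      using cM[of x] by simp
    have le: "card {e \<in> M \<inter> E c. fst e = x \<or> snd e = x} \<le> 1" if "c \<in> C" for c x
      using member_le_sum[OF that, of "\<lambda>c. card {e \<in> M \<inter> E c. fst e = x \<or> snd e = x}"] finC sum[of x]
      by (cases "x \<in> V") auto
    have eq: "card {e \<in> M \<inter> E c. fst e = x \<or> snd e = x} =
        of_bool (x \<in> {x. \<exists>e\<in>M \<inter> E c. fst e = x \<or> snd e = x})" if "c \<in> C" for c x
    proof (cases "\<exists>e\<in>M \<inter> E c. fst e = x \<or> snd e = x")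
      case True
      then have "{e \<in> M \<inter> E c. fst e = x \<or> snd e = x} \<noteq> {}" by blast
      moreover have "finite {e \<in> M \<inter> E c. fst e = x \<or> snd e = x}" using finE[OF that] by simp
      ultimately have "card {e \<in> M \<inter> E c. fst e = x \<or> snd e = x} \<noteq> 0"
        unfolding card_eq_0_iff by blast
      with le[OF that, of x] have "card {e \<in> M \<inter> E c. fst e = x \<or> snd e = x} = 1" by linarith
      moreover have "x \<in> {x. \<exists>e\<in>M \<inter> E c. fst e = x \<or> snd e = x}" using True by blast
      ultimately show ?thesis by (simp only: of_bool_eq)
    next
      case False
      then have "{e \<in> M \<inter> E c. fst e = x \<or> snd e = x} = {}" by auto
      moreover have "x \<notin> {x. \<exists>e\<in>M \<inter> E c. fst e = x \<or> snd e = x}" using False by blast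
      ultimately show ?thesis by (simp only: of_bool_eq card.empty)
    qed
    have "card {c \<in> C. x \<in> {x. \<exists>e\<in>M \<inter> E c. fst e = x \<or> snd e = x}} = of_bool (x \<in> V)" for x
      using sum[of x] by (simp only: eq sum_of_bool_card[OF finC] cong: sum.cong)
    then have "(\<lambda>c\<in>C. {x. \<exists>e\<in>M \<inter> E c. fst e = x \<or> snd e = x}) \<in> cell_covers C K V"
      using ends by (auto simp: cell_covers_def cong: conj_cong)
    moreover have "M \<inter> E c \<in> matchings (E c) {x. \<exists>e\<in>M \<inter> E c. fst e = x \<or> snd e = x}" if "c \<in> C" for c
      unfolding matchings_def using eq[OF that] by blast
    ultimately show "to M \<in> T" by (auto simp: to_def T_def)
  qed
  finally show ?thesis by (simp add: matching_sum_def)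
qed

text \<open>At every point the counts of a cover and of its complement in \<open>K\<close> add up to
  the number of cells there, so complementing exchanges the roles of \<open>V\<close> and
  \<open>V'\<close>. Doing it twice gives back the cover.\<close>

lemma sum_cell_covers_complement:
  assumes finC: "finite C"
    and card: "\<And>x. card {c \<in> C. x \<in> K c} = of_bool (x \<in> V) + of_bool (x \<in> V')"
  shows "(\<Sum>\<sigma>\<in>cell_covers C K V. F \<sigma>) = (\<Sum>\<sigma>\<in>cell_covers C K V'. F (\<lambda>c\<in>C. K c - \<sigma> c))"
proof -
  have split: "card {c \<in> C. x \<in> K c - \<sigma> c} + card {c \<in> C. x \<in> \<sigma> c} = card {c \<in> C. x \<in> K c}"
    if "\<sigma> \<in> PiE C (\<lambda>c. Pow (K c))" for \<sigma> x
  proof -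
    have "{c \<in> C. x \<in> K c} = {c \<in> C. x \<in> K c - \<sigma> c} \<union> {c \<in> C. x \<in> \<sigma> c}"
      using that by (auto simp: PiE_iff)
    also have "card \<dots> = card {c \<in> C. x \<in> K c - \<sigma> c} + card {c \<in> C. x \<in> \<sigma> c}"
      using finC by (intro card_Un_disjoint) auto
    finally show ?thesis by simp
  qed
  have compl: "(\<lambda>c\<in>C. K c - \<sigma> c) \<in> cell_covers C K B"
    if "\<sigma> \<in> cell_covers C K A" "\<And>x. card {c \<in> C. x \<in> K c} = of_bool (x \<in> A) + of_bool (x \<in> B)"
    for \<sigma> A B
  proof -
    have \<sigma>: "\<sigma> \<in> PiE C (\<lambda>c. Pow (K c))" "\<And>x. card {c \<in> C. x \<in> \<sigma> c} = of_bool (x \<in> A)"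
      using that(1) by (auto simp: cell_covers_def)
    have "card {c \<in> C. x \<in> K c - \<sigma> c} = of_bool (x \<in> B)" for x
      using split[OF \<sigma>(1), of x] \<sigma>(2)[of x] that(2)[of x] by simp
    then show ?thesis by (auto simp: cell_covers_def cong: conj_cong)
  qed
  have invol: "(\<lambda>c\<in>C. K c - (\<lambda>c\<in>C. K c - \<sigma> c) c) = \<sigma>" if "\<sigma> \<in> cell_covers C K A" for \<sigma> A
    using that by (auto simp: cell_covers_def PiE_iff extensional_def fun_eq_iff double_diff)
  show ?thesis
    using compl[where A = V and B = V'] compl[where A = V' and B = V] card invol
    by (intro sum.reindex_bij_witness[where i = "\<lambda>\<sigma>. \<lambda>c\<in>C. K c - \<sigma> c" and j = "\<lambda>\<sigma>. \<lambda>c\<in>C. K c - \<sigma> c"])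
      (simp_all add: add.commute)
qed

text \<open>The sets \<open>\<sigma> c\<close> partition \<open>V\<close>, because elements of
  \<open>V\<close> have count 1 and all others count 0.\<close>

lemma prod_cell_covers:
  assumes finC: "finite C" and finK: "\<And>c. c \<in> C \<Longrightarrow> finite (K c)"
    and \<sigma>: "\<sigma> \<in> cell_covers C K V"
  shows "(\<Prod>v\<in>V. h v) = (\<Prod>c\<in>C. \<Prod>v\<in>\<sigma> c. h v)"
proof -
  have card: "card {c \<in> C. x \<in> \<sigma> c} = of_bool (x \<in> V)" for x
    using \<sigma> by (auto simp: cell_covers_def)
  have sub: "\<sigma> c \<subseteq> K c" if "c \<in> C" for c using \<sigma> that by (auto simp: cell_covers_def PiE_iff)
  have V: "V = (\<Union>c\<in>C. \<sigma> c)"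
  proof -
    have "x \<in> V \<longleftrightarrow> {c \<in> C. x \<in> \<sigma> c} \<noteq> {}" for x
      using nonempty_iff_card_of_bool[OF _ card[of x]] finC by simp
    then show ?thesis by auto
  qed
  have disj: "\<sigma> c \<inter> \<sigma> d = {}" if "c \<in> C" "d \<in> C" "c \<noteq> d" for c d
  proof (rule ccontr)
    assume "\<sigma> c \<inter> \<sigma> d \<noteq> {}"
    then obtain x where x: "x \<in> \<sigma> c" "x \<in> \<sigma> d" by auto
    have "card {c, d} \<le> card {c \<in> C. x \<in> \<sigma> c}"
      using finC that x by (intro card_mono) auto
    with card[of x] that show False by (cases "x \<in> V") auto
  qed
  show ?thesis unfolding V using finC finK sub disj
    by (intro prod.UNION_disjoint) (auto intro: finite_subset)
qed

text \<open>\<open>V\<close> will be the vertex set of the larger diamond and \<open>V'\<close> that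
  of the smaller one. A cell identity may carry a factor \<open>h v\<close> for each corner in
  \<open>s\<close>: the corner sets of a cover partition \<open>V'\<close>, so these local factors
  merge into one factor per vertex of \<open>V'\<close>, the same for all covers.\<close>

lemma matching_sum_complement:
  assumes finC: "finite C" and finE: "\<And>c. c \<in> C \<Longrightarrow> finite (E c)"
    and disj: "disjoint_family_on E C"
    and finK: "\<And>c. c \<in> C \<Longrightarrow> finite (K c)"
    and ends: "\<And>c e. c \<in> C \<Longrightarrow> e \<in> E c \<Longrightarrow> fst e \<in> K c \<and> snd e \<in> K c"
    and card: "\<And>x. card {c \<in> C. x \<in> K c} = of_bool (x \<in> V) + of_bool (x \<in> V')"
    and cell: "\<And>c s. c \<in> C \<Longrightarrow> s \<subseteq> K c \<Longrightarrow>
      matching_sum (E c) wt (K c - s) * (\<Prod>v\<in>s. h v) = \<kappa> c * matching_sum (E c) wt' s"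
  shows "matching_sum (\<Union>c\<in>C. E c) wt V * (\<Prod>v\<in>V'. h v) =
    (\<Prod>c\<in>C. \<kappa> c) * matching_sum (\<Union>c\<in>C. E c) wt' V'"
proof -
  have "matching_sum (\<Union>c\<in>C. E c) wt V * (\<Prod>v\<in>V'. h v) =
      (\<Sum>\<sigma>\<in>cell_covers C K V'. (\<Prod>c\<in>C. matching_sum (E c) wt (K c - \<sigma> c)) * (\<Prod>v\<in>V'. h v))"
    by (simp add: matching_sum_cells[OF finC finE disj finK ends]
        sum_cell_covers_complement[OF finC card] sum_distrib_right cong: prod.cong)
  also have "\<dots> = (\<Sum>\<sigma>\<in>cell_covers C K V'. (\<Prod>c\<in>C. \<kappa> c * matching_sum (E c) wt' (\<sigma> c)))"
  proof (rule sum.cong[OF refl])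
    fix \<sigma> assume \<sigma>: "\<sigma> \<in> cell_covers C K V'"
    then have "\<sigma> c \<subseteq> K c" if "c \<in> C" for c using that by (auto simp: cell_covers_def PiE_iff)
    then show "(\<Prod>c\<in>C. matching_sum (E c) wt (K c - \<sigma> c)) * (\<Prod>v\<in>V'. h v) =
        (\<Prod>c\<in>C. \<kappa> c * matching_sum (E c) wt' (\<sigma> c))"
      by (simp add: prod_cell_covers[OF finC finK \<sigma>] cell flip: prod.distrib)
  qed
  also have "\<dots> = (\<Prod>c\<in>C. \<kappa> c) * matching_sum (\<Union>c\<in>C. E c) wt' V'"
    by (simp add: matching_sum_cells[OF finC finE disj finK ends] prod.distrib sum_distrib_left)
  finally show ?thesis .
qed

section \<open>Matching sums on a 4-cycle\<close>

lemma matching_sum_empty: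
  assumes "finite E"
  shows "matching_sum E wt {} = 1"
proof -
  have "matchings E {} = {{}}"
  proof
    show "matchings E {} \<subseteq> {{}}"
      using matching_ends(1)[OF assms] by blast
  qed (simp add: matchings_def)
  then show ?thesis by (simp add: matching_sum_def)
qed

text \<open>Configurations are sorted by the unique edge that covers \<open>v\<close>, as in the
  expansion of a permanent along a row.\<close>

lemma matching_sum_expand:
  assumes finE: "finite E" and v: "v \<in> V" and noloop: "\<And>e. e \<in> E \<Longrightarrow> fst e \<noteq> snd e"
  shows "matching_sum E wt V =
    (\<Sum>e\<in>{e \<in> E. (fst e = v \<or> snd e = v) \<and> fst e \<in> V \<and> snd e \<in> V}.
       wt e * matching_sum E wt (V - {fst e, snd e}))"
proof -
  define D where "D = {e \<in> E. (fst e = v \<or> snd e = v) \<and> fst e \<in> V \<and> snd e \<in> V}"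
  define T where "T = (SIGMA e:D. matchings E (V - {fst e, snd e}))"
  define mate where "mate = (\<lambda>M. THE e. e \<in> M \<and> (fst e = v \<or> snd e = v))"
  have mate: "mate M = e" "e \<notin> M - {e}"
    if M: "M \<in> matchings E V" and e: "e \<in> M" "fst e = v \<or> snd e = v" for M e
  proof -
    have "card {e \<in> M. fst e = v \<or> snd e = v} = Suc 0" using M v by (simp add: matchings_def)
    then obtain a where a: "{e \<in> M. fst e = v \<or> snd e = v} = {a}" unfolding card_1_singleton_iff by blast
    have "e \<in> {a}" unfolding a[symmetric] using e by simp
    then have "a = e" by simp
    show "mate M = e"
      unfolding mate_def
    proof (rule the_equality)
      show "e' = e" if "e' \<in> M \<and> (fst e' = v \<or> snd e' = v)" for e'
      proof -
        have "e' \<in> {a}" unfolding a[symmetric] using that by simp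
        with \<open>a = e\<close> show ?thesis by simp
      qed
    qed (use e in simp)
  qed simp
  have del: "e \<in> D" "M - {e} \<in> matchings E (V - {fst e, snd e})"
    if M: "M \<in> matchings E V" and e: "e \<in> M" "fst e = v \<or> snd e = v" for M e
  proof -
    have fin: "finite M" and ME: "M \<subseteq> E" using M finE by (auto simp: matchings_def intro: finite_subset)
    show "e \<in> D" using matching_ends[OF finE M e(1)] e ME by (auto simp: D_def)
    have "card {e' \<in> M - {e}. fst e' = x \<or> snd e' = x} = of_bool (x \<in> V - {fst e, snd e})" for x
    proof (cases "x \<in> {fst e, snd e}")
      case True
      then have "{e' \<in> M. fst e' = x \<or> snd e' = x} = insert e {e' \<in> M - {e}. fst e' = x \<or> snd e' = x}"
        using e by auto
      then have "card {e' \<in> M. fst e' = x \<or> snd e' = x} = Suc (card {e' \<in> M - {e}. fst e' = x \<or> snd e' = x})"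
        using fin by simp
      with True M matching_ends[OF finE M e(1)] show ?thesis by (auto simp: matchings_def)
    next
      case False
      then have "{e' \<in> M - {e}. fst e' = x \<or> snd e' = x} = {e' \<in> M. fst e' = x \<or> snd e' = x}" by auto
      with False M show ?thesis by (auto simp: matchings_def)
    qed
    with ME show "M - {e} \<in> matchings E (V - {fst e, snd e})" by (auto simp: matchings_def)
  qed
  have ins: "insert e M \<in> matchings E V" "e \<notin> M"
    if e: "e \<in> D" and M: "M \<in> matchings E (V - {fst e, snd e})" for M e
  proof -
    have fin: "finite M" and ME: "M \<subseteq> E" using M finE by (auto simp: matchings_def intro: finite_subset)
    show nin: "e \<notin> M" using matching_ends(1)[OF finE M, of e] by auto
    have "card {e' \<in> insert e M. fst e' = x \<or> snd e' = x} = of_bool (x \<in> V)" for x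
    proof (cases "x \<in> {fst e, snd e}")
      case True
      then have "{e' \<in> insert e M. fst e' = x \<or> snd e' = x} = insert e {e' \<in> M. fst e' = x \<or> snd e' = x}"
        by auto
      then have "card {e' \<in> insert e M. fst e' = x \<or> snd e' = x} = Suc (card {e' \<in> M. fst e' = x \<or> snd e' = x})"
        using fin nin by simp
      with True M e show ?thesis by (auto simp: matchings_def D_def)
    next
      case False
      then have "{e' \<in> insert e M. fst e' = x \<or> snd e' = x} = {e' \<in> M. fst e' = x \<or> snd e' = x}" by auto
      with False M show ?thesis by (auto simp: matchings_def)
    qed
    with ME e show "insert e M \<in> matchings E V" by (auto simp: matchings_def D_def)
  qed
  have ex: "\<exists>e\<in>M. fst e = v \<or> snd e = v" if "M \<in> matchings E V" for M
  proof -
    have "card {e \<in> M. fst e = v \<or> snd e = v} = Suc 0" using that v by (simp add: matchings_def)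
    then obtain a where a: "{e \<in> M. fst e = v \<or> snd e = v} = {a}" unfolding card_1_singleton_iff by blast
    have "a \<in> {e \<in> M. fst e = v \<or> snd e = v}" unfolding a by simp
    then show ?thesis by blast
  qed
  have finD: "finite D" using finE by (simp add: D_def)
  have "(\<Sum>e\<in>D. wt e * matching_sum E wt (V - {fst e, snd e})) =
      (\<Sum>e\<in>D. \<Sum>M\<in>matchings E (V - {fst e, snd e}). wt e * (\<Prod>e\<in>M. wt e))"
    by (simp add: matching_sum_def sum_distrib_left)
  also have "\<dots> = (\<Sum>(e, M)\<in>T. wt e * (\<Prod>e\<in>M. wt e))"
    unfolding T_def using finD finE by (intro sum.Sigma) (auto intro: finite_matchings)
  also have "\<dots> = matching_sum E wt V"
    unfolding matching_sum_def
  proof (rule sum.reindex_bij_witness[where i = "\<lambda>M. (mate M, M - {mate M})" and j = "\<lambda>(e, M). insert e M"])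
    fix p assume "p \<in> T"
    then obtain e M where p: "p = (e, M)" and e: "e \<in> D" and M: "M \<in> matchings E (V - {fst e, snd e})"
      by (auto simp: T_def)
    have mate_e: "mate (insert e M) = e"
      using mate(1)[OF ins(1)[OF e M], of e] e by (auto simp: D_def)
    have fin: "finite M" using M finE by (auto simp: matchings_def intro: finite_subset)
    show "(mate (case p of (e, M) \<Rightarrow> insert e M), (case p of (e, M) \<Rightarrow> insert e M) -
        {mate (case p of (e, M) \<Rightarrow> insert e M)}) = p"
      using mate_e ins(2)[OF e M] by (simp add: p)
    show "(case p of (e, M) \<Rightarrow> insert e M) \<in> matchings E V" using ins(1)[OF e M] by (simp add: p)
    show "(\<Prod>e\<in>(case p of (e, M) \<Rightarrow> insert e M). wt e) = (case p of (e, M) \<Rightarrow> wt e * (\<Prod>e\<in>M. wt e))"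
      using fin ins(2)[OF e M] by (simp add: p)
  next
    fix M assume M: "M \<in> matchings E V"
    from ex[OF M] obtain e where e: "e \<in> M" "fst e = v \<or> snd e = v" by blast
    show "(case (mate M, M - {mate M}) of (e, M) \<Rightarrow> insert e M) = M"
      using mate(1)[OF M e] e by auto
    show "(mate M, M - {mate M}) \<in> T" using mate(1)[OF M e] del[OF M e] by (simp add: T_def)
  qed
  finally show ?thesis by (simp add: D_def)
qed

text \<open>The points run around a square. Only the empty set, the four sides and the whole square
  can be covered, and the complement of a side is the opposite side. So six of the sixteen subsets
  give a relation, and the others read 0 = 0. The empty subset forces \<kappa> to be the total
  weight of the square under \<open>wt\<close>.\<close>

lemma matching_sum_square_relation:
  fixes A B C D :: 'v
  assumes dist: "distinct [A, B, C, D]"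
    and E: "E = {(A, B), (B, A), (B, C), (C, B), (C, D), (D, C), (D, A), (A, D)}"
    and p: "p = wt (A, B) + wt (B, A)" and q: "q = wt (B, C) + wt (C, B)"
    and r: "r = wt (C, D) + wt (D, C)" and s: "s = wt (D, A) + wt (A, D)"
    and p': "p' = wt' (A, B) + wt' (B, A)" and q': "q' = wt' (B, C) + wt' (C, B)"
    and r': "r' = wt' (C, D) + wt' (D, C)" and s': "s' = wt' (D, A) + wt' (A, D)"
    and none: "p * r + q * s = \<kappa>"
    and AB: "r * (h A * h B) = \<kappa> * p'" and BC: "s * (h B * h C) = \<kappa> * q'"
    and CD: "p * (h C * h D) = \<kappa> * r'" and DA: "q * (h A * h D) = \<kappa> * s'"
    and all: "h A * (h B * (h C * h D)) = \<kappa> * (p' * r' + q' * s')"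
    and S: "S \<subseteq> {A, B, C, D}"
  shows "matching_sum E wt ({A, B, C, D} - S) * (\<Prod>v\<in>S. h v) = \<kappa> * matching_sum E wt' S"
proof -
  have finE: "finite E" and noloop: "\<And>e. e \<in> E \<Longrightarrow> fst e \<noteq> snd e"
    using dist by (auto simp: E)
  note empty = matching_sum_empty[OF finE]
  \<comment> \<open>The term of the dart (x, y) in the expansion at \<open>v\<close>, set to 0 for
    inadmissible darts, so that the sum runs over all eight of them.\<close>
  define T where "T = (\<lambda>w v V x y. if (x = v \<or> y = v) \<and> x \<in> V \<and> y \<in> V
    then w (x, y) * matching_sum E w (V - {x, y}) else 0)"
  have neq: "A \<noteq> B" "A \<noteq> C" "A \<noteq> D" "B \<noteq> C" "B \<noteq> D" "C \<noteq> D"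
    "B \<noteq> A" "C \<noteq> A" "D \<noteq> A" "C \<noteq> B" "D \<noteq> B" "D \<noteq> C"
    using dist by auto
  have single: "matching_sum E w {v} = 0" for w v
  proof -
    have none: "{e \<in> E. (fst e = v \<or> snd e = v) \<and> fst e \<in> {v} \<and> snd e \<in> {v}} = {}"
      using noloop by fastforce
    show ?thesis by (subst matching_sum_expand[OF finE _ noloop, of v]) (simp_all only: none sum.empty singletonI)
  qed
  have expand: "matching_sum E w V = T w v V A B + T w v V B A + T w v V B C + T w v V C B +
      T w v V C D + T w v V D C + T w v V D A + T w v V A D" if "v \<in> V" for w v V
  proof -
    have "matching_sum E w V = (\<Sum>e\<in>E. T w v V (fst e) (snd e))"
      by (subst matching_sum_expand[OF finE that noloop])
        (simp_all only: sum.inter_filter[OF finE] T_def prod.collapse)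
    also have "\<dots> = T w v V A B + T w v V B A + T w v V B C + T w v V C B +
      T w v V C D + T w v V D C + T w v V D A + T w v V A D"
      using neq by (simp add: E)
    finally show ?thesis .
  qed
  have pair: "matching_sum E w {A, B} = w (A, B) + w (B, A)"
    "matching_sum E w {B, C} = w (B, C) + w (C, B)"
    "matching_sum E w {C, D} = w (C, D) + w (D, C)"
    "matching_sum E w {A, D} = w (D, A) + w (A, D)"
    "matching_sum E w {A, C} = 0" "matching_sum E w {B, D} = 0" for w
    by (subst expand, rule insertI1, simp add: T_def neq empty insert_Diff_if)+
  have triple: "matching_sum E w {A, B, C} = 0" "matching_sum E w {A, B, D} = 0"
    "matching_sum E w {A, C, D} = 0" "matching_sum E w {B, C, D} = 0" for w
    by (subst expand, rule insertI1, simp add: T_def neq single insert_Diff_if)+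
  have quad: "matching_sum E w {A, B, C, D} =
      (w (A, B) + w (B, A)) * (w (C, D) + w (D, C)) + (w (B, C) + w (C, B)) * (w (D, A) + w (A, D))" for w
    by (subst expand, rule insertI1) (simp add: T_def neq pair insert_Diff_if algebra_simps)
  \<comment> \<open>Four membership bits make \<open>S\<close> explicit in each of the sixteen
    cases.\<close>
  obtain a b c d where "a \<longleftrightarrow> A \<in> S" "b \<longleftrightarrow> B \<in> S" "c \<longleftrightarrow> C \<in> S" "d \<longleftrightarrow> D \<in> S"
    by simp
  then have "S = (if d then {D} else {}) \<union> ((if c then {C} else {}) \<union>
      ((if b then {B} else {}) \<union> (if a then {A} else {})))"
    using S by (auto split: if_splits)
  then show ?thesis
    by (cases a; cases b; cases c; cases d)
      (simp_all add: insert_Diff_if neq single pair triple quad empty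
         p[symmetric] q[symmetric] r[symmetric] s[symmetric]
         p'[symmetric] q'[symmetric] r'[symmetric] s'[symmetric] none AB BC CD DA all)
qed

section \<open>Geometry of Aztec diamonds\<close>

text \<open>The coordinate sum has the parity of the distance to the centre. The index is the size
  of the smaller diamond: the cells with index \<open>k\<close> carry the edges of the diamond of
  size k + 1.\<close>

definition aztec_cells :: "nat \<Rightarrow> face \<Rightarrow> face set" where
  "aztec_cells k c = {f \<in> aztec_faces k c. even (fst f + snd f + fst c + snd c + int k)}"

lemma aztec_faces_iff [simp]: "(i, j) \<in> aztec_faces k (u, v) \<longleftrightarrow> \<bar>i - u\<bar> + \<bar>j - v\<bar> \<le> int k"
  by (simp add: aztec_faces_def)

lemma internal_faces_iff [simp]: "(i, j) \<in> internal_faces k (u, v) \<longleftrightarrow> \<bar>i - u\<bar> + \<bar>j - v\<bar> < int k"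
  by (simp add: internal_faces_def)

lemma aztec_cells_iff [simp]:
  "(i, j) \<in> aztec_cells k (u, v) \<longleftrightarrow> \<bar>i - u\<bar> + \<bar>j - v\<bar> \<le> int k \<and> even (i + j + u + v + int k)"
  by (simp add: aztec_cells_def)

text \<open>Serves to sharpen a distance bound k + 1 to k for faces of cell parity.\<close>

lemma cell_parity:
  assumes "even (i + j + u + v + int k)"
  shows "\<bar>i - u\<bar> + \<bar>j - v\<bar> \<noteq> int k + 1"
proof
  assume "\<bar>i - u\<bar> + \<bar>j - v\<bar> = int k + 1"
  then have "odd (\<bar>i - u\<bar> + \<bar>j - v\<bar> + int k)" by simp
  with assms show False by (auto simp: even_abs_add_iff)
qed

lemma cell_faces:
  assumes "(i, j) \<in> aztec_cells k c"
  shows "(i, j) \<in> aztec_faces k c" "(i, j) \<in> aztec_faces (Suc k) c"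
    "(i+1, j) \<in> aztec_faces (Suc k) c" "(i, j+1) \<in> aztec_faces (Suc k) c"
    "(i-1, j) \<in> aztec_faces (Suc k) c" "(i, j-1) \<in> aztec_faces (Suc k) c"
proof -
  obtain u v where c: "c = (u, v)" by fastforce
  have le: "\<bar>i - u\<bar> + \<bar>j - v\<bar> \<le> int k" using assms by (simp add: c)
  have "\<bar>i + 1 - u\<bar> \<le> \<bar>i - u\<bar> + 1" "\<bar>i - 1 - u\<bar> \<le> \<bar>i - u\<bar> + 1"
    "\<bar>j + 1 - v\<bar> \<le> \<bar>j - v\<bar> + 1" "\<bar>j - 1 - v\<bar> \<le> \<bar>j - v\<bar> + 1" by linarith+
  with le show "(i, j) \<in> aztec_faces k c" "(i, j) \<in> aztec_faces (Suc k) c"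
    "(i+1, j) \<in> aztec_faces (Suc k) c" "(i, j+1) \<in> aztec_faces (Suc k) c"
    "(i-1, j) \<in> aztec_faces (Suc k) c" "(i, j-1) \<in> aztec_faces (Suc k) c"
    unfolding c aztec_faces_iff of_nat_Suc by (simp_all; fail | linarith)+
qed

lemma finite_aztec_faces: "finite (aztec_faces k c)"
proof (rule finite_subset)
  show "aztec_faces k c \<subseteq> {fst c - int k..fst c + int k} \<times> {snd c - int k..snd c + int k}"
  proof
    fix f assume "f \<in> aztec_faces k c"
    then have "\<bar>fst f - fst c\<bar> + \<bar>snd f - snd c\<bar> \<le> int k"
      by (cases f; cases c) simp
    then show "f \<in> {fst c - int k..fst c + int k} \<times> {snd c - int k..snd c + int k}"
      unfolding mem_Times_iff atLeastAtMost_iff by linarith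
  qed
qed simp

lemma finite_aztec_cells: "finite (aztec_cells k c)"
  by (simp add: aztec_cells_def finite_aztec_faces)

lemma corners_iff: "(p, q) \<in> corners (i, j) \<longleftrightarrow> (i = p \<or> i = p - 1) \<and> (j = q \<or> j = q - 1)"
  by auto

text \<open>The vertex is the point (p - 1/2, q - 1/2). In doubled coordinates the condition says
  that its taxicab distance to the centre is at most k.\<close>

lemma aztec_vertices_iff:
  "(p, q) \<in> aztec_vertices k (u, v) \<longleftrightarrow> \<bar>2 * p - 1 - 2 * u\<bar> + \<bar>2 * q - 1 - 2 * v\<bar> \<le> 2 * int k"
proof -
  have "(p, q) \<in> aztec_vertices k (u, v) \<longleftrightarrow>
      (p, q) \<in> internal_faces k (u, v) \<or> (p - 1, q) \<in> internal_faces k (u, v) \<or>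
      (p, q - 1) \<in> internal_faces k (u, v) \<or> (p - 1, q - 1) \<in> internal_faces k (u, v)"
    unfolding aztec_vertices_def UN_iff Bex_def split_paired_Ex corners_iff by blast
  also have "\<dots> \<longleftrightarrow> \<bar>2 * p - 1 - 2 * u\<bar> + \<bar>2 * q - 1 - 2 * v\<bar> \<le> 2 * int k"
    unfolding internal_faces_iff
    by (cases "p \<ge> u + 1"; cases "q \<ge> v + 1"; auto simp: abs_if; presburger)
  finally show ?thesis .
qed

lemma finite_aztec_vertices: "finite (aztec_vertices k c)"
proof -
  have "finite (internal_faces k c)"
    by (rule finite_subset[OF _ finite_aztec_faces[of k c]]) (auto simp: internal_faces_def aztec_faces_def)
  moreover have "finite (corners f)" for f by (cases f) simp
  ultimately show ?thesis by (simp add: aztec_vertices_def)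
qed

lemma corners_cyclic: "corners (i, j) = {(i, j), (i+1, j), (i+1, j+1), (i, j+1)}"
  by auto

lemma adjacent_iff:
  "adjacent (p, q) (r, s) \<longleftrightarrow> r = p \<and> (s = q + 1 \<or> s = q - 1) \<or> s = q \<and> (r = p + 1 \<or> r = p - 1)"
  unfolding adjacent.simps by presburger

lemma face_darts_iff:
  "((p, q), (r, s)) \<in> face_darts (i, j) \<longleftrightarrow>
     p = r \<and> (s = q + 1 \<and> j = q \<or> s = q - 1 \<and> j = s) \<and> (i = p \<or> i = p - 1) \<or>
     q = s \<and> (r = p + 1 \<and> i = p \<or> r = p - 1 \<and> i = r) \<and> (j = q \<or> j = q - 1)"
  unfolding face_darts_def mem_Collect_eq prod.case corners_iff adjacent_iff by presburger

lemma face_darts_cyclic: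
  "face_darts (i, j) =
     {((i, j), (i+1, j)), ((i+1, j), (i, j)), ((i+1, j), (i+1, j+1)), ((i+1, j+1), (i+1, j)),
      ((i+1, j+1), (i, j+1)), ((i, j+1), (i+1, j+1)), ((i, j+1), (i, j)), ((i, j), (i, j+1))}"
  (is "_ = ?D")
proof -
  have "((p, q), (r, s)) \<in> face_darts (i, j) \<longleftrightarrow> ((p, q), (r, s)) \<in> ?D" for p q r s
    unfolding face_darts_iff insert_iff empty_iff prod.inject by presburger
  then show ?thesis by (simp only: set_eq_iff split_paired_All) blast
qed

lemma finite_face_darts: "finite (face_darts f)"
  by (cases f) (simp add: face_darts_cyclic)

lemma face_darts_ends: "e \<in> face_darts f \<Longrightarrow> fst e \<in> corners f \<and> snd e \<in> corners f"
  by (auto simp: face_darts_def)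

text \<open>Coordinate sums of faces that share an edge differ by 1, whereas those of two cells have
  the same parity.\<close>

lemma disjoint_face_darts_cells: "disjoint_family_on face_darts (aztec_cells k c)"
proof -
  have "f = g" if f: "f \<in> aztec_cells k c" "e \<in> face_darts f"
    and g: "g \<in> aztec_cells k c" "e \<in> face_darts g" for e f g
  proof -
    obtain p q r s i j i' j' u v where eqs: "e = ((p, q), (r, s))" "f = (i, j)" "g = (i', j')" "c = (u, v)"
      by (metis surj_pair)
    have "even (i + j + u + v + int k)" "even (i' + j' + u + v + int k)"
      using f(1) g(1) unfolding eqs by simp_all
    then have par: "i + j + 1 \<noteq> i' + j'" "i' + j' + 1 \<noteq> i + j" by presburger+
    have "r = p \<and> s = q + 1 \<or> r = p \<and> s = q - 1 \<or> s = q \<and> r = p + 1 \<or> s = q \<and> r = p - 1"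
      using f(2) unfolding eqs face_darts_iff by blast
    then show ?thesis
      using f(2) g(2) par unfolding eqs by (elim disjE) (auto simp: face_darts_iff)
  qed
  then show ?thesis
    unfolding disjoint_family_on_def disjoint_iff by blast
qed

text \<open>The diamond is an induced subgraph of the square lattice. This later decides from its
  ends alone whether a dart belongs to the smaller diamond.\<close>

lemma aztec_darts_iff:
  "((p, q), (r, s)) \<in> aztec_darts k (u, v) \<longleftrightarrow> \<bar>p - r\<bar> + \<bar>q - s\<bar> = 1 \<and>
     (p, q) \<in> aztec_vertices k (u, v) \<and> (r, s) \<in> aztec_vertices k (u, v)"
proof
  assume "((p, q), (r, s)) \<in> aztec_darts k (u, v)"
  then show "\<bar>p - r\<bar> + \<bar>q - s\<bar> = 1 \<and>
     (p, q) \<in> aztec_vertices k (u, v) \<and> (r, s) \<in> aztec_vertices k (u, v)"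
    unfolding aztec_darts_def aztec_vertices_def face_darts_def by auto
next
  assume *: "\<bar>p - r\<bar> + \<bar>q - s\<bar> = 1 \<and>
     (p, q) \<in> aztec_vertices k (u, v) \<and> (r, s) \<in> aztec_vertices k (u, v)"
  then have adj: "r = p \<and> s = q + 1 \<or> r = p \<and> s = q - 1 \<or> s = q \<and> r = p + 1 \<or> s = q \<and> r = p - 1"
    by (auto simp: abs_if split: if_splits)
  \<comment> \<open>For a horizontal edge with left end (a, b), the adjacent face on the side of the
    centre is internal. Vertical edges use the same inequality with the coordinates
    exchanged.\<close>
  have inner: "\<bar>a - c\<bar> + \<bar>(if b > d then b - 1 else b) - d\<bar> < int k"
    if "\<bar>2 * a - 1 - 2 * c\<bar> + \<bar>2 * b - 1 - 2 * d\<bar> \<le> 2 * int k"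
      "\<bar>2 * (a + 1) - 1 - 2 * c\<bar> + \<bar>2 * b - 1 - 2 * d\<bar> \<le> 2 * int k" for a b c d
    using that by (cases "a \<ge> c + 1"; cases "b \<ge> d + 1"; simp add: abs_if; presburger?)
  have "(\<exists>f\<in>internal_faces k (u, v). ((p, q), (r, s)) \<in> face_darts f)"
    using adj
  proof (elim disjE)
    assume rs: "r = p \<and> s = q + 1"
    show ?thesis
      using * inner[of q v p u] unfolding aztec_vertices_iff
      by (intro bexI[of _ "(if p > u then p - 1 else p, q)"]) (auto simp: rs face_darts_iff algebra_simps)
  next
    assume rs: "r = p \<and> s = q - 1"
    show ?thesis
      using * inner[of s v p u] unfolding aztec_vertices_iff
      by (intro bexI[of _ "(if p > u then p - 1 else p, s)"]) (auto simp: rs face_darts_iff algebra_simps)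
  next
    assume rs: "s = q \<and> r = p + 1"
    show ?thesis
      using * inner[of p u q v] unfolding aztec_vertices_iff
      by (intro bexI[of _ "(p, if q > v then q - 1 else q)"]) (auto simp: rs face_darts_iff algebra_simps)
  next
    assume rs: "s = q \<and> r = p - 1"
    show ?thesis
      using * inner[of r u q v] unfolding aztec_vertices_iff
      by (intro bexI[of _ "(r, if q > v then q - 1 else q)"]) (auto simp: rs face_darts_iff algebra_simps)
  qed
  then show "((p, q), (r, s)) \<in> aztec_darts k (u, v)"
    unfolding aztec_darts_def by blast
qed

text \<open>Of the two faces along an edge one has the parity of the cells. Both are within distance
  k + 1, and for that one \<open>cell_parity\<close> improves the bound to k.\<close>

lemma aztec_darts_eq_cells: "aztec_darts (Suc k) c = (\<Union>f\<in>aztec_cells k c. face_darts f)"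
proof -
  obtain u v where c: "c = (u, v)" by fastforce
  have "aztec_cells k c \<subseteq> internal_faces (Suc k) c" by (auto simp: c)
  moreover have "((p, q), (r, s)) \<in> (\<Union>f\<in>aztec_cells k c. face_darts f)"
    if "((p, q), (r, s)) \<in> aztec_darts (Suc k) c" for p q r s
  proof -
    have *: "\<bar>p - r\<bar> + \<bar>q - s\<bar> = 1" "(p, q) \<in> aztec_vertices (Suc k) (u, v)"
      "(r, s) \<in> aztec_vertices (Suc k) (u, v)"
      using that unfolding c aztec_darts_iff by blast+
    then have adj: "r = p \<and> s = q + 1 \<or> r = p \<and> s = q - 1 \<or> s = q \<and> r = p + 1 \<or> s = q \<and> r = p - 1"
      by presburger
    have dist: "\<bar>a - c\<bar> + \<bar>b - d\<bar> \<le> int k + 1 \<and> \<bar>a - c\<bar> + \<bar>b - 1 - d\<bar> \<le> int k + 1"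
      if "\<bar>2 * a - 1 - 2 * c\<bar> + \<bar>2 * b - 1 - 2 * d\<bar> \<le> 2 * int (Suc k)"
        "\<bar>2 * (a + 1) - 1 - 2 * c\<bar> + \<bar>2 * b - 1 - 2 * d\<bar> \<le> 2 * int (Suc k)" for a b c d
      using that by (cases "a \<ge> c + 1"; cases "b \<ge> d + 1"; simp add: abs_if; presburger?)
    have cell: "(i, j) \<in> aztec_cells k (u, v)"
      if "\<bar>i - u\<bar> + \<bar>j - v\<bar> \<le> int k + 1" "even (i + j + u + v + int k)" for i j
      using that cell_parity[of i j u v k] by simp
    have hor: "(a, b) \<in> aztec_cells k (u, v) \<or> (a, b - 1) \<in> aztec_cells k (u, v)"
      if "(a, b) \<in> aztec_vertices (Suc k) (u, v)" "(a + 1, b) \<in> aztec_vertices (Suc k) (u, v)" for a b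
    proof -
      have "even (a + b + u + v + int k) \<or> even (a + (b - 1) + u + v + int k)" by presburger
      with dist[of a u b v] that show ?thesis unfolding aztec_vertices_iff by (metis cell)
    qed
    have ver: "(a, b) \<in> aztec_cells k (u, v) \<or> (a - 1, b) \<in> aztec_cells k (u, v)"
      if "(a, b) \<in> aztec_vertices (Suc k) (u, v)" "(a, b + 1) \<in> aztec_vertices (Suc k) (u, v)" for a b
    proof -
      have "even (a + b + u + v + int k) \<or> even (a - 1 + b + u + v + int k)" by presburger
      with dist[of b v a u] that show ?thesis unfolding aztec_vertices_iff by (metis cell add.commute)
    qed
    show ?thesis
      using adj
    proof (elim disjE)
      assume rs: "r = p \<and> s = q + 1"
      have "((p, q), (r, s)) \<in> face_darts (p, q)" "((p, q), (r, s)) \<in> face_darts (p - 1, q)"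
        by (simp_all add: face_darts_iff rs)
      moreover have "(p, q) \<in> aztec_cells k (u, v) \<or> (p - 1, q) \<in> aztec_cells k (u, v)"
        using * ver[of p q] rs by (simp del: aztec_cells_iff)
      ultimately show ?thesis unfolding c by blast
    next
      assume rs: "r = p \<and> s = q - 1"
      have "((p, q), (r, s)) \<in> face_darts (p, s)" "((p, q), (r, s)) \<in> face_darts (p - 1, s)"
        by (simp_all add: face_darts_iff rs)
      moreover have "(p, s) \<in> aztec_cells k (u, v) \<or> (p - 1, s) \<in> aztec_cells k (u, v)"
        using * ver[of p s] rs by (simp del: aztec_cells_iff)
      ultimately show ?thesis unfolding c by blast
    next
      assume rs: "s = q \<and> r = p + 1"
      have "((p, q), (r, s)) \<in> face_darts (p, q)" "((p, q), (r, s)) \<in> face_darts (p, q - 1)"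
        by (simp_all add: face_darts_iff rs)
      moreover have "(p, q) \<in> aztec_cells k (u, v) \<or> (p, q - 1) \<in> aztec_cells k (u, v)"
        using * hor[of p q] rs by (simp del: aztec_cells_iff)
      ultimately show ?thesis unfolding c by blast
    next
      assume rs: "s = q \<and> r = p - 1"
      have "((p, q), (r, s)) \<in> face_darts (r, q)" "((p, q), (r, s)) \<in> face_darts (r, q - 1)"
        by (simp_all add: face_darts_iff rs)
      moreover have "(r, q) \<in> aztec_cells k (u, v) \<or> (r, q - 1) \<in> aztec_cells k (u, v)"
        using * hor[of r q] rs by (simp del: aztec_cells_iff)
      ultimately show ?thesis unfolding c by blast
    qed
  qed
  ultimately show ?thesis unfolding aztec_darts_def by force
qed

section \<open>Incidences of vertices, cells and the remaining faces\<close>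

lemma corner_count_even:
  fixes P Q K :: int
  assumes "even (P + Q + K)"
  shows "of_bool (\<bar>P\<bar> + \<bar>Q\<bar> \<le> K) + of_bool (\<bar>P - 1\<bar> + \<bar>Q - 1\<bar> \<le> K) =
    (of_bool (\<bar>2 * P - 1\<bar> + \<bar>2 * Q - 1\<bar> \<le> 2 * K + 2) + of_bool (\<bar>2 * P - 1\<bar> + \<bar>2 * Q - 1\<bar> \<le> 2 * K) :: nat)"
proof -
  \<comment> \<open>\<open>P\<close> and \<open>Q\<close> locate the face to the upper right of the
    vertex relative to the centre, so 2P - 1 and 2Q - 1 locate the vertex in doubled coordinates.
    Substituting for \<open>K\<close> builds the parity condition into the inequalities.\<close>
  obtain n where n: "K = 2 * n - P - Q" using assms by (elim evenE) (metis add_diff_cancel_left' diff_diff_eq)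
  show ?thesis unfolding n of_bool_def by (cases "P \<ge> 1"; cases "Q \<ge> 1"; simp add: abs_if; presburger?)
qed

lemma corner_count_odd:
  fixes P Q K :: int
  assumes "odd (P + Q + K)"
  shows "of_bool (\<bar>P - 1\<bar> + \<bar>Q\<bar> \<le> K) + of_bool (\<bar>P\<bar> + \<bar>Q - 1\<bar> \<le> K) =
    (of_bool (\<bar>2 * P - 1\<bar> + \<bar>2 * Q - 1\<bar> \<le> 2 * K + 2) + of_bool (\<bar>2 * P - 1\<bar> + \<bar>2 * Q - 1\<bar> \<le> 2 * K) :: nat)"
proof -
  obtain n where n: "K = 2 * n + 1 - P - Q" using assms by (elim oddE) (metis add_diff_cancel_left' diff_diff_eq)
  show ?thesis unfolding n of_bool_def by (cases "P \<ge> 1"; cases "Q \<ge> 1"; simp add: abs_if; presburger?)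
qed

text \<open>The hypothesis \<open>card\<close> of \<open>matching_sum_complement\<close> for the
  diamonds of sizes k + 1 and k. Among the four faces at a vertex, the candidates for cells form one
  of the two diagonal pairs, selected by parity.\<close>

lemma card_corner_cells:
  "card {f \<in> aztec_cells k c. x \<in> corners f} =
     of_bool (x \<in> aztec_vertices (Suc k) c) + of_bool (x \<in> aztec_vertices k c)"
proof -
  obtain u v p q where c: "c = (u, v)" and x: "x = (p, q)" by fastforce
  have filt: "card {f \<in> {a, b}. f \<in> aztec_faces k (u, v)} =
      of_bool (a \<in> aztec_faces k (u, v)) + of_bool (b \<in> aztec_faces k (u, v))" if "a \<noteq> b" for a b
  proof -
    have "{f \<in> {a, b}. f \<in> aztec_faces k (u, v)} =
        (if a \<in> aztec_faces k (u, v) then {a} else {}) \<union> (if b \<in> aztec_faces k (u, v) then {b} else {})"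
      by auto
    then show ?thesis using that by simp
  qed
  have "card {f \<in> aztec_cells k (u, v). (p, q) \<in> corners f} =
      of_bool (\<bar>2 * p - 1 - 2 * u\<bar> + \<bar>2 * q - 1 - 2 * v\<bar> \<le> 2 * int (Suc k)) +
      of_bool (\<bar>2 * p - 1 - 2 * u\<bar> + \<bar>2 * q - 1 - 2 * v\<bar> \<le> 2 * int k)"
  proof (cases "even (p + q + u + v + int k)")
    case True
    have "{f \<in> aztec_cells k (u, v). (p, q) \<in> corners f} =
        {f \<in> {(p, q), (p - 1, q - 1)}. f \<in> aztec_faces k (u, v)}"
      using True by (auto simp: corners_iff simp del: corners.simps)
    also have "card \<dots> = of_bool ((p, q) \<in> aztec_faces k (u, v)) + of_bool ((p - 1, q - 1) \<in> aztec_faces k (u, v))"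
      by (rule filt) simp
    finally show ?thesis
      using corner_count_even[of "p - u" "q - v" "int k"] True by (simp add: algebra_simps)
  next
    case False
    have "{f \<in> aztec_cells k (u, v). (p, q) \<in> corners f} =
        {f \<in> {(p - 1, q), (p, q - 1)}. f \<in> aztec_faces k (u, v)}"
      using False by (auto simp: corners_iff simp del: corners.simps)
    also have "card \<dots> = of_bool ((p - 1, q) \<in> aztec_faces k (u, v)) + of_bool ((p, q - 1) \<in> aztec_faces k (u, v))"
      by (rule filt) simp
    finally show ?thesis
      using corner_count_odd[of "p - u" "q - v" "int k"] False by (simp add: algebra_simps)
  qed
  then show ?thesis unfolding c x aztec_vertices_iff .
qed

text \<open>The order of the two faces is such that the weight difference across a vertex, which serves as
  gauge, has the same sign seen from either of the two cells that meet there.\<close>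

fun diagonal_faces :: "bool \<Rightarrow> vertex \<Rightarrow> face \<times> face" where
  "diagonal_faces ev (p, q) = (if ev then ((p, q - 1), (p - 1, q)) else ((p - 1, q - 1), (p, q)))"

text \<open>The parity tested is the one for which the face (p, q), to the upper right of the vertex
  (p, q), is of cell type; then the other diagonal pair is taken, and otherwise the pair through
  this face.\<close>

definition noncell_faces :: "nat \<Rightarrow> face \<Rightarrow> vertex \<Rightarrow> face \<times> face" where
  "noncell_faces k c x = diagonal_faces (even (fst x + snd x + fst c + snd c + int k)) x"

definition neighbours :: "face \<Rightarrow> face set" where
  "neighbours f = {(fst f + 1, snd f), (fst f, snd f + 1), (fst f - 1, snd f), (fst f, snd f - 1)}"

text \<open>The count of exponents behind \<open>prod_noncells\<close>, for a face of non-cell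
  parity at (P, Q). In the interior it reads 4 + 1 = 4 + 1, on a side of the diamond 1 + 1 = 2 + 0,
  and at a tip 0 + 1 = 1 + 0.\<close>

lemma card_noncell_incidences:
  fixes P Q K :: int
  assumes "odd (P + Q + K)" "\<bar>P\<bar> + \<bar>Q\<bar> \<le> K + 1" "0 \<le> K"
  shows "of_bool (\<bar>2 * P - 1\<bar> + \<bar>2 * Q - 1\<bar> \<le> 2 * K) + of_bool (\<bar>2 * P + 1\<bar> + \<bar>2 * Q - 1\<bar> \<le> 2 * K) +
      of_bool (\<bar>2 * P + 1\<bar> + \<bar>2 * Q + 1\<bar> \<le> 2 * K) + of_bool (\<bar>2 * P - 1\<bar> + \<bar>2 * Q + 1\<bar> \<le> 2 * K) + 1 =
    (of_bool (\<bar>P + 1\<bar> + \<bar>Q\<bar> \<le> K) + of_bool (\<bar>P\<bar> + \<bar>Q + 1\<bar> \<le> K) +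
      of_bool (\<bar>P - 1\<bar> + \<bar>Q\<bar> \<le> K) + of_bool (\<bar>P\<bar> + \<bar>Q - 1\<bar> \<le> K) + of_bool (\<bar>P\<bar> + \<bar>Q\<bar> \<le> K) :: nat)"
proof -
  \<comment> \<open>Parity excludes the distance K. What remains is the boundary at K + 1, where the
    signs of the coordinates tell sides from tips, and the interior.\<close>
  have "odd (\<bar>P\<bar> + \<bar>Q\<bar> + K)" using assms(1) by (simp add: even_abs_add_iff)
  then have "\<bar>P\<bar> + \<bar>Q\<bar> \<noteq> K" by auto
  with assms(2) consider "K = \<bar>P\<bar> + \<bar>Q\<bar> - 1" | "\<bar>P\<bar> + \<bar>Q\<bar> + 1 \<le> K" by linarith
  then show ?thesis
  proof cases
    case 1
    show ?thesis
      using assms(3) unfolding 1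
      by (cases "P \<ge> 1"; cases "P = 0"; cases "Q \<ge> 1"; cases "Q = 0"; simp add: abs_if)
  next
    case 2
    have bounds: "\<bar>x + 1\<bar> \<le> \<bar>x\<bar> + 1" "\<bar>x - 1\<bar> \<le> \<bar>x\<bar> + 1" "\<bar>2 * x + 1\<bar> \<le> 2 * \<bar>x\<bar> + 1"
      "\<bar>2 * x - 1\<bar> \<le> 2 * \<bar>x\<bar> + 1" for x :: int
      by (simp_all add: abs_if)
    have le: "a + b \<le> K" if "a \<le> \<bar>P\<bar> + 1" "b \<le> \<bar>Q\<bar>" for a b using that 2 by (rule_tac order_trans[OF add_mono[OF that]]) simp
    have le': "a + b \<le> K" if "a \<le> \<bar>P\<bar>" "b \<le> \<bar>Q\<bar> + 1" for a b using that 2 by (rule_tac order_trans[OF add_mono[OF that]]) simp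
    have le2: "a + b \<le> 2 * K" if "a \<le> 2 * \<bar>P\<bar> + 1" "b \<le> 2 * \<bar>Q\<bar> + 1" for a b
      using that 2 by (rule_tac order_trans[OF add_mono[OF that]]) simp
    show ?thesis
      using 2 le[OF bounds(1) order_refl] le[OF bounds(2) order_refl]
        le'[OF order_refl bounds(1)] le'[OF order_refl bounds(2)]
        le2[OF bounds(3) bounds(3)] le2[OF bounds(3) bounds(4)] le2[OF bounds(4) bounds(3)] le2[OF bounds(4) bounds(4)]
      by simp
  qed
qed

lemma card_four_filter:
  assumes "distinct [a, b, c, d]"
  shows "card {x \<in> {a, b, c, d}. P x} = of_bool (P a) + of_bool (P b) + of_bool (P c) + of_bool (P d)"
proof -
  have "card {x \<in> {a, b, c, d}. P x} = (\<Sum>x\<in>{a, b, c, d}. of_bool (P x))"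
    by (subst sum_of_bool_eq) (simp_all add: Int_def)
  also have "\<dots> = of_bool (P a) + of_bool (P b) + of_bool (P c) + of_bool (P d)"
    using assms by simp
  finally show ?thesis .
qed

lemma card_noncell:
  assumes f: "f \<in> aztec_faces (Suc k) c"
    "odd (fst f + snd f + fst c + snd c + int k)"
  shows "card {x \<in> aztec_vertices k c. x \<in> corners f} + 1 =
    card {g \<in> aztec_cells k c. f \<in> neighbours g} + of_bool (f \<in> aztec_faces k c)"
proof -
  obtain u v i j where c: "c = (u, v)" and ij: "f = (i, j)" by fastforce
  have odd: "odd (i + j + u + v + int k)" and le: "\<bar>i - u\<bar> + \<bar>j - v\<bar> \<le> int k + 1"
    using f by (simp_all add: c ij)
  have "{x \<in> aztec_vertices k c. x \<in> corners f} =
      {x \<in> {(i, j), (i+1, j), (i+1, j+1), (i, j+1)}. x \<in> aztec_vertices k c}"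
    unfolding ij corners_cyclic by blast
  then have 1: "card {x \<in> aztec_vertices k c. x \<in> corners f} =
      of_bool ((i, j) \<in> aztec_vertices k c) + of_bool ((i+1, j) \<in> aztec_vertices k c) +
      of_bool ((i+1, j+1) \<in> aztec_vertices k c) + of_bool ((i, j+1) \<in> aztec_vertices k c)"
    by (simp only: card_four_filter) (subst card_four_filter, simp_all)
  have "{g \<in> aztec_cells k c. f \<in> neighbours g} =
      {g \<in> {(i+1, j), (i, j+1), (i-1, j), (i, j-1)}. g \<in> aztec_cells k c}"
    unfolding ij neighbours_def by (auto simp del: aztec_cells_iff)
  then have 2: "card {g \<in> aztec_cells k c. f \<in> neighbours g} =
      of_bool ((i+1, j) \<in> aztec_cells k c) + of_bool ((i, j+1) \<in> aztec_cells k c) +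
      of_bool ((i-1, j) \<in> aztec_cells k c) + of_bool ((i, j-1) \<in> aztec_cells k c)"
    by (simp only: card_four_filter) (subst card_four_filter, simp_all)
  have "odd ((i - u) + (j - v) + int k)" using odd by presburger
  from card_noncell_incidences[OF this] le show ?thesis
    unfolding 1 2 unfolding c ij aztec_vertices_iff aztec_cells_iff aztec_faces_iff
    using odd by (simp add: algebra_simps)
qed

section \<open>Oriented dimers as exact covers, and the algebra of one cell\<close>

lemma ex1_iff_card: "(\<exists>!e. e \<in> A) \<longleftrightarrow> card A = Suc 0"
proof
  assume "\<exists>!e. e \<in> A"
  then obtain e where "e \<in> A" "\<forall>e'. e' \<in> A \<longrightarrow> e' = e" by (rule ex1E)
  then have "A = {e}" by blast
  then show "card A = Suc 0" by simp
next
  assume "card A = Suc 0"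
  then obtain e where "A = {e}" unfolding card_1_singleton_iff by (elim exE)
  then show "\<exists>!e. e \<in> A" by simp
qed

lemma oriented_dimers_eq_matchings:
  "oriented_dimers k c = matchings (aztec_darts k c) (aztec_vertices k c)"
proof -
  have ends: "fst e \<in> aztec_vertices k c \<and> snd e \<in> aztec_vertices k c" if "e \<in> aztec_darts k c" for e
  proof -
    obtain f where f: "f \<in> internal_faces k c" "e \<in> face_darts f"
      using \<open>e \<in> aztec_darts k c\<close> unfolding aztec_darts_def by (rule UN_E)
    then show ?thesis
      unfolding aztec_vertices_def using face_darts_ends[OF f(2)] by (intro conjI UN_I[OF f(1)]) simp_all
  qed
  have "(\<forall>x\<in>aztec_vertices k c. \<exists>!e. e \<in> M \<and> (fst e = x \<or> snd e = x)) \<longleftrightarrow>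
      (\<forall>x. card {e \<in> M. fst e = x \<or> snd e = x} = of_bool (x \<in> aztec_vertices k c))"
    if M: "M \<subseteq> aztec_darts k c" for M
  proof -
    have 0: "card {e \<in> M. fst e = x \<or> snd e = x} = 0" if "x \<notin> aztec_vertices k c" for x
    proof -
      have "{e \<in> M. fst e = x \<or> snd e = x} = {}"
      proof (rule equals0I)
        fix e assume "e \<in> {e \<in> M. fst e = x \<or> snd e = x}"
        then have e: "e \<in> M" "fst e = x \<or> snd e = x" by simp_all
        show False using ends[OF subsetD[OF M e(1)]] e(2) that by (elim disjE) simp_all
      qed
      then show ?thesis by (simp only: card.empty)
    qed
    have 1: "(\<exists>!e. e \<in> M \<and> (fst e = x \<or> snd e = x)) \<longleftrightarrow> card {e \<in> M. fst e = x \<or> snd e = x} = Suc 0" for x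
      using ex1_iff_card[of "{e \<in> M. fst e = x \<or> snd e = x}"] by (simp only: mem_Collect_eq)
    show ?thesis unfolding 1
    proof (intro iffI allI ballI)
      fix x assume *: "\<forall>x\<in>aztec_vertices k c. card {e \<in> M. fst e = x \<or> snd e = x} = Suc 0"
      show "card {e \<in> M. fst e = x \<or> snd e = x} = of_bool (x \<in> aztec_vertices k c)"
        using bspec[OF *, of x] 0[of x] by (cases "x \<in> aztec_vertices k c") (simp_all only: of_bool_eq One_nat_def not_False_eq_True)
    next
      fix x assume *: "\<forall>x. card {e \<in> M. fst e = x \<or> snd e = x} = of_bool (x \<in> aztec_vertices k c)"
        and x: "x \<in> aztec_vertices k c"
      show "card {e \<in> M. fst e = x \<or> snd e = x} = Suc 0"
        using spec[OF *, of x] x by (simp only: of_bool_eq One_nat_def)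
    qed
  qed
  then show ?thesis
    unfolding oriented_dimers_def matchings_def by (intro Collect_cong conj_cong refl)
qed

lemma dimer_Z_eq_matching_sum:
  "dimer_Z k c \<phi> a =
     matching_sum (aztec_darts k c) (\<lambda>e. \<phi> e * a (right_face e)) (aztec_vertices k c)"
  by (simp add: dimer_Z_def matching_sum_def oriented_dimers_eq_matchings)

lemma matchings_enlarge:
  assumes "finite E'" "E \<subseteq> E'" "\<And>e. e \<in> E' \<Longrightarrow> fst e \<in> V \<Longrightarrow> snd e \<in> V \<Longrightarrow> e \<in> E"
  shows "matchings E V = matchings E' V"
proof (intro equalityI subsetI)
  fix M assume "M \<in> matchings E V"
  with assms(2) show "M \<in> matchings E' V"
    unfolding matchings_def mem_Collect_eq by (meson subset_trans)
next
  fix M assume M: "M \<in> matchings E' V"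
  have "M \<subseteq> E"
  proof
    fix e assume e: "e \<in> M"
    have "e \<in> E'" using M e unfolding matchings_def by blast
    then show "e \<in> E" using assms(3) matching_ends[OF assms(1) M e] by blast
  qed
  with M show "M \<in> matchings E V"
    unfolding matchings_def mem_Collect_eq by meson
qed

lemma finite_cell_darts: "finite (\<Union>f\<in>aztec_cells k c. face_darts f)"
  by (simp add: finite_aztec_cells finite_face_darts)

text \<open>Complementation keeps the edge set of the cells, which is that of the larger diamond.
  Its surplus darts have an end outside the smaller diamond, so they cannot occur in a cover of the
  smaller vertex set.\<close>

lemma matching_sum_aztec_cells:
  "matching_sum (\<Union>f\<in>aztec_cells k c. face_darts f) wt (aztec_vertices k c) =
     matching_sum (aztec_darts k c) wt (aztec_vertices k c)"
proof -
  have "matchings (aztec_darts k c) (aztec_vertices k c) =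
      matchings (\<Union>f\<in>aztec_cells k c. face_darts f) (aztec_vertices k c)"
  proof (rule matchings_enlarge[OF finite_cell_darts])
    show "aztec_darts k c \<subseteq> (\<Union>f\<in>aztec_cells k c. face_darts f)"
      unfolding aztec_darts_eq_cells[symmetric] aztec_darts_def
      by (intro UN_mono) (auto simp: internal_faces_def)
    fix e assume e: "e \<in> (\<Union>f\<in>aztec_cells k c. face_darts f)" "fst e \<in> aztec_vertices k c" "snd e \<in> aztec_vertices k c"
    obtain p q r s u v where eq: "e = ((p, q), (r, s))" "c = (u, v)" by (metis surj_pair)
    show "e \<in> aztec_darts k c"
      using e unfolding aztec_darts_eq_cells[symmetric] unfolding eq aztec_darts_iff by simp
  qed
  then show ?thesis by (simp add: matching_sum_def)
qed

text \<open>The six relations of \<open>matching_sum_square_relation\<close>, where \<open>x\<close>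
  and \<open>x'\<close> are the old and new weights of the cell and \<open>a\<close>,
  \<open>b\<close>, \<open>c\<close>, \<open>d\<close> those of its east, north, west and south
  neighbours. Solving the dSKP equation for x' turns x' - d into 1/\<delta> times the opposite old
  difference x - b times two differences of consecutive neighbours; the latter are the gauge factors
  at the ends of the southern edge. The other sides are analogous.\<close>

lemma square_weights:
  fixes x x' a b c d sa sb sc sd m :: complex
  assumes dskp: "(x' - a) * (x - b) * (c - d) = - (x' - d) * (x - c) * (a - b)"
    and ne: "a \<noteq> b" "b \<noteq> c" "c \<noteq> d" "d \<noteq> a"
    and signs: "sa * sa = 1" "sb * sb = 1" "sc * sc = 1" "sd * sd = 1" "sa * sb * sc * sd = -1"
    and m: "m * m = 1"
    and \<kappa>: "\<kappa> = - (sa * sc) * ((x - b) * (x - d) - (x - a) * (x - c))"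
  shows "sd * (x - d) * (sb * (x - b)) + sa * (x - a) * (sc * (x - c)) = \<kappa>"
    and "sb * (x - b) * (m * (d - c) * (m * (d - a))) = \<kappa> * (sd * (x' - d))"
    and "sc * (x - c) * (m * (d - a) * (m * (a - b))) = \<kappa> * (- sa * (x' - a))"
    and "sd * (x - d) * (m * (a - b) * (m * (c - b))) = \<kappa> * (sb * (x' - b))"
    and "sa * (x - a) * (m * (d - c) * (m * (c - b))) = \<kappa> * (- sc * (x' - c))"
    and "m * (d - c) * (m * (d - a) * (m * (a - b) * (m * (c - b)))) =
      \<kappa> * (sd * (x' - d) * (sb * (x' - b)) + - sa * (x' - a) * (- sc * (x' - c)))"
proof -
  define \<delta> where "\<delta> = (x - b) * (x - d) - (x - a) * (x - c)"
  \<comment> \<open>The Kasteleyn condition gives the two pairs of opposite sides opposite signs.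
    Thus the weight of the whole square is a difference of two products, a multiple of
    \<delta>.\<close>
  have sbd: "sb * sd = - (sa * sc)" "sa * sc * sd = - sb" "sa * sb * sc = - sd"
    using signs by algebra+
  have d: "\<delta> * (x' - d) = (x - b) * (c - d) * (a - d)" using dskp unfolding \<delta>_def by algebra
  have a: "\<delta> * (x' - a) = (x - c) * (a - b) * (d - a)" using dskp unfolding \<delta>_def by algebra
  have b: "\<delta> * (x' - b) = (x - d) * (b - a) * (b - c)" using dskp unfolding \<delta>_def by algebra
  have c: "\<delta> * (x' - c) = (x - a) * (c - b) * (d - c)" using dskp unfolding \<delta>_def by algebra
  have "\<delta> \<noteq> 0"
  proof
    assume "\<delta> = 0"
    then have "x = b" "x = c" "x = d" using a b d ne by auto
    then show False using ne by simp
  qed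
  have \<kappa>\<delta>: "\<kappa> = - (sa * sc) * \<delta>" by (simp add: \<kappa> \<delta>_def)
  show "sd * (x - d) * (sb * (x - b)) + sa * (x - a) * (sc * (x - c)) = \<kappa>"
    using sbd(1) unfolding \<kappa> by algebra
  show "sb * (x - b) * (m * (d - c) * (m * (d - a))) = \<kappa> * (sd * (x' - d))"
    using d sbd(2) m unfolding \<kappa>\<delta> by algebra
  show "sc * (x - c) * (m * (d - a) * (m * (a - b))) = \<kappa> * (- sa * (x' - a))"
    using a signs(1) m unfolding \<kappa>\<delta> by algebra
  show "sd * (x - d) * (m * (a - b) * (m * (c - b))) = \<kappa> * (sb * (x' - b))"
    using b sbd(3) m unfolding \<kappa>\<delta> by algebra
  show "sa * (x - a) * (m * (d - c) * (m * (c - b))) = \<kappa> * (- sc * (x' - c))"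
    using c signs(3) m unfolding \<kappa>\<delta> by algebra
  \<comment> \<open>The dual of the first relation. Replacing all four new differences by old ones
    takes a second factor \<delta>, which is cancelled at the end.\<close>
  have prod: "\<delta> * ((x' - a) * (x' - c) - (x' - b) * (x' - d)) = - ((d - c) * (d - a) * (a - b) * (c - b))"
  proof -
    have "\<delta> * (\<delta> * ((x' - a) * (x' - c) - (x' - b) * (x' - d))) =
        (\<delta> * (x' - a)) * (\<delta> * (x' - c)) - (\<delta> * (x' - b)) * (\<delta> * (x' - d))"
      by algebra
    also have "\<dots> = \<delta> * - ((d - c) * (d - a) * (a - b) * (c - b))"
      unfolding a b c d unfolding \<delta>_def by algebra
    finally show ?thesis by (rule mult_left_cancel[OF \<open>\<delta> \<noteq> 0\<close>, THEN iffD1])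
  qed
  have ss: "sa * sa * (sc * sc) = 1" using signs by simp
  have "\<kappa> * (sd * (x' - d) * (sb * (x' - b)) + - sa * (x' - a) * (- sc * (x' - c))) =
      - (sa * sa * (sc * sc)) * (\<delta> * ((x' - a) * (x' - c) - (x' - b) * (x' - d)))"
    using sbd(1) unfolding \<kappa>\<delta> by algebra
  also have "\<dots> = (d - c) * (d - a) * (a - b) * (c - b)" unfolding ss prod by simp
  finally show "m * (d - c) * (m * (d - a) * (m * (a - b) * (m * (c - b)))) =
      \<kappa> * (sd * (x' - d) * (sb * (x' - b)) + - sa * (x' - a) * (- sc * (x' - c)))"
    using m by algebra
qed

section \<open>One step of the recursion\<close>

lemma face_product:
  fixes \<phi> :: "dart \<Rightarrow> complex"
  shows "(\<Prod>e\<in>{(x, y) \<in> face_darts (i, j). white x}. \<phi> e) =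
    (if even (i + j)
     then \<phi> ((i, j), (i+1, j)) * \<phi> ((i, j), (i, j+1)) * \<phi> ((i+1, j+1), (i+1, j)) * \<phi> ((i+1, j+1), (i, j+1))
     else \<phi> ((i+1, j), (i, j)) * \<phi> ((i+1, j), (i+1, j+1)) * \<phi> ((i, j+1), (i+1, j+1)) * \<phi> ((i, j+1), (i, j)))"
proof -
  have "{(x, y) \<in> face_darts (i, j). white x} = {e \<in> face_darts (i, j). white (fst e)}"
    by auto
  then have "(\<Prod>e\<in>{(x, y) \<in> face_darts (i, j). white x}. \<phi> e) =
      (\<Prod>e\<in>face_darts (i, j). if white (fst e) then \<phi> e else 1)"
    by (simp only: prod.inter_filter[OF finite_face_darts])
  also have "\<dots> = (if even (i + j)
     then \<phi> ((i, j), (i+1, j)) * \<phi> ((i, j), (i, j+1)) * \<phi> ((i+1, j+1), (i+1, j)) * \<phi> ((i+1, j+1), (i, j+1))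
     else \<phi> ((i+1, j), (i, j)) * \<phi> ((i+1, j), (i+1, j+1)) * \<phi> ((i, j+1), (i+1, j+1)) * \<phi> ((i, j+1), (i, j)))"
    unfolding face_darts_cyclic by (simp add: mult_ac)
  finally show ?thesis .
qed

lemma internal_face_darts: "f \<in> internal_faces k c \<Longrightarrow> face_darts f \<subseteq> aztec_darts k c"
  by (auto simp: aztec_darts_def)

text \<open>\<open>sa\<close>, \<open>sb\<close>, \<open>sc\<close>, \<open>sd\<close> belong to the
  clockwise darts on the east, north, west and south side, those with the face on their right. The
  white-to-black darts differ from them by two reversals, so the product is -1 for either colouring
  of the corners.\<close>

lemma kasteleyn_face:
  assumes kast: "kasteleyn_orientation k c \<phi>" and f: "(i, j) \<in> internal_faces k c"
  defines "sa \<equiv> \<phi> ((i+1, j+1), (i+1, j))" and "sb \<equiv> \<phi> ((i, j+1), (i+1, j+1))"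
    and "sc \<equiv> \<phi> ((i, j), (i, j+1))" and "sd \<equiv> \<phi> ((i+1, j), (i, j))"
  shows "sa * sa = 1" "sb * sb = 1" "sc * sc = 1" "sd * sd = 1" "sa * sb * sc * sd = -1"
    "\<phi> ((i+1, j), (i+1, j+1)) = - sa" "\<phi> ((i+1, j+1), (i, j+1)) = - sb"
    "\<phi> ((i, j+1), (i, j)) = - sc" "\<phi> ((i, j), (i+1, j)) = - sd"
proof -
  have darts: "((i+1, j+1), (i+1, j)) \<in> aztec_darts k c" "((i, j+1), (i+1, j+1)) \<in> aztec_darts k c"
    "((i, j), (i, j+1)) \<in> aztec_darts k c" "((i+1, j), (i, j)) \<in> aztec_darts k c"
    by (rule subsetD[OF internal_face_darts[OF f]], simp add: face_darts_iff)+
  have sgn: "\<phi> (x, y) \<in> {-1, 1}" "\<phi> (y, x) = - \<phi> (x, y)" if "(x, y) \<in> aztec_darts k c" for x y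
    using kast that unfolding kasteleyn_orientation_def by blast+
  have sq: "z * z = 1" if "z \<in> {-1, 1}" for z :: complex using that by auto
  show "sa * sa = 1" "sb * sb = 1" "sc * sc = 1" "sd * sd = 1"
    unfolding sa_def sb_def sc_def sd_def by (intro sq sgn(1) darts)+
  show opp: "\<phi> ((i+1, j), (i+1, j+1)) = - sa" "\<phi> ((i+1, j+1), (i, j+1)) = - sb"
    "\<phi> ((i, j+1), (i, j)) = - sc" "\<phi> ((i, j), (i+1, j)) = - sd"
    unfolding sa_def sb_def sc_def sd_def by (intro sgn(2) darts)+
  have "(\<Prod>e\<in>{(x, y) \<in> face_darts (i, j). white x}. \<phi> e) = -1"
    using kast f unfolding kasteleyn_orientation_def by blast
  then show "sa * sb * sc * sd = -1"
    unfolding face_product opp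
    by (simp add: sa_def[symmetric] sb_def[symmetric] sc_def[symmetric] sd_def[symmetric] mult_ac
        split: if_splits)
qed

text \<open>Complementation exchanges opposite edges of a cell; this change of sign makes the complemented
  weights agree with the new ones, and keeps the orientation Kasteleyn.\<close>

definition flip_vertical :: "(dart \<Rightarrow> complex) \<Rightarrow> dart \<Rightarrow> complex" where
  "flip_vertical \<phi> e = (if fst (fst e) = fst (snd e) then - \<phi> e else \<phi> e)"

text \<open>Every face has two vertical edges, so the two changes of sign cancel in its
  product.\<close>

lemma kasteleyn_flip_vertical:
  assumes kast: "kasteleyn_orientation (Suc k) c \<phi>"
  shows "kasteleyn_orientation k c (flip_vertical \<phi>)"
proof -
  have int: "internal_faces k c \<subseteq> internal_faces (Suc k) c" by (auto simp: internal_faces_def)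
  then have darts: "aztec_darts k c \<subseteq> aztec_darts (Suc k) c" by (auto simp: aztec_darts_def)
  have "flip_vertical \<phi> (x, y) \<in> {-1, 1} \<and> flip_vertical \<phi> (y, x) = - flip_vertical \<phi> (x, y)"
    if "(x, y) \<in> aztec_darts k c" for x y
  proof -
    have "\<phi> (x, y) \<in> {-1, 1}" "\<phi> (y, x) = - \<phi> (x, y)"
      using kast that darts unfolding kasteleyn_orientation_def by blast+
    then show ?thesis by (auto simp: flip_vertical_def)
  qed
  moreover have "(\<Prod>e\<in>{(x, y) \<in> face_darts f. white x}. flip_vertical \<phi> e) = -1"
    if "f \<in> internal_faces k c" for f
  proof -
    obtain i j where f: "f = (i, j)" by fastforce
    have "(\<Prod>e\<in>{(x, y) \<in> face_darts f. white x}. \<phi> e) = -1"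
      using kast that int unfolding kasteleyn_orientation_def by blast
    then show ?thesis
      unfolding f face_product by (simp add: flip_vertical_def split: if_splits)
  qed
  ultimately show ?thesis unfolding kasteleyn_orientation_def by blast
qed

text \<open>The factor \<open>sa * sc\<close> of \<kappa> in \<open>square_weights\<close>.\<close>

definition cell_sign :: "(dart \<Rightarrow> complex) \<Rightarrow> face \<Rightarrow> complex" where
  "cell_sign \<phi> f = \<phi> ((fst f + 1, snd f + 1), (fst f + 1, snd f)) * \<phi> (f, (fst f, snd f + 1))"

text \<open>\<open>m\<close> will be \<open>wedge M L\<close>, the sign that scales all weight
  differences in a chart. Putting it into the gauge \<open>h\<close> makes \<open>h\<close> free of
  that sign.\<close>

lemma dimer_Z_step:
  fixes x x' :: "face \<Rightarrow> complex" and m :: complex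
  assumes kast: "kasteleyn_orientation (Suc k) c \<phi>" and m: "m * m = 1"
    and same: "\<And>f. f \<in> aztec_faces (Suc k) c \<Longrightarrow> f \<notin> aztec_cells k c \<Longrightarrow> x' f = x f"
    and dskp: "\<And>i j. (i, j) \<in> aztec_cells k c \<Longrightarrow>
      (x' (i, j) - x (i+1, j)) * (x (i, j) - x (i, j+1)) * (x (i-1, j) - x (i, j-1)) =
      - (x' (i, j) - x (i, j-1)) * (x (i, j) - x (i-1, j)) * (x (i+1, j) - x (i, j+1))"
    and ne: "\<And>i j. (i, j) \<in> aztec_cells k c \<Longrightarrow>
      x (i+1, j) \<noteq> x (i, j+1) \<and> x (i, j+1) \<noteq> x (i-1, j) \<and>
      x (i-1, j) \<noteq> x (i, j-1) \<and> x (i, j-1) \<noteq> x (i+1, j)"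
  defines "\<kappa> \<equiv> \<lambda>f. - cell_sign \<phi> f *
    ((x f - x (fst f, snd f + 1)) * (x f - x (fst f, snd f - 1)) -
     (x f - x (fst f + 1, snd f)) * (x f - x (fst f - 1, snd f)))"
    and "h \<equiv> \<lambda>v. m * (x (fst (noncell_faces k c v)) - x (snd (noncell_faces k c v)))"
  shows "dimer_Z (Suc k) c \<phi> x * (\<Prod>v\<in>aztec_vertices k c. h v) =
    (\<Prod>f\<in>aztec_cells k c. \<kappa> f) * dimer_Z k c (flip_vertical \<phi>) x'"
proof -
  let ?wt = "\<lambda>e. \<phi> e * x (right_face e)"
  let ?wt' = "\<lambda>e. flip_vertical \<phi> e * x' (right_face e)"
  have cell: "matching_sum (face_darts f) ?wt (corners f - s) * (\<Prod>v\<in>s. h v) =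
      \<kappa> f * matching_sum (face_darts f) ?wt' s"
    if f: "f \<in> aztec_cells k c" and s: "s \<subseteq> corners f" for f s
  proof -
    obtain i j u v where ij: "f = (i, j)" and c: "c = (u, v)" by fastforce
    have par: "even (i + j + u + v + int k)" using f by (simp add: ij c)
    have int: "(i, j) \<in> internal_faces (Suc k) c" using f by (simp add: ij c)
    note signs = kasteleyn_face[OF kast int]
    note wts = square_weights[OF dskp[OF f[unfolded ij]] conjunct1[OF ne[OF f[unfolded ij]]]
        conjunct1[OF conjunct2[OF ne[OF f[unfolded ij]]]]
        conjunct1[OF conjunct2[OF conjunct2[OF ne[OF f[unfolded ij]]]]]
        conjunct2[OF conjunct2[OF conjunct2[OF ne[OF f[unfolded ij]]]]] signs(1-5) m refl]
    have \<kappa>: "\<kappa> (i, j) = - (\<phi> ((i+1, j+1), (i+1, j)) * \<phi> ((i, j), (i, j+1))) *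
        ((x (i, j) - x (i, j+1)) * (x (i, j) - x (i, j-1)) - (x (i, j) - x (i+1, j)) * (x (i, j) - x (i-1, j)))"
      by (simp add: \<kappa>_def cell_sign_def)
    have e: "even (i + j + u + v + int k) = True" "even (i + 1 + j + u + v + int k) = False"
      "even (i + (j + 1) + u + v + int k) = False" "even (i - 1 + j + u + v + int k) = False"
      "even (i + (j - 1) + u + v + int k) = False" "even (i + 1 + (j + 1) + u + v + int k) = True"
      using par by presburger+
    \<comment> \<open>The neighbours of a cell have the other parity, so their weights do not change
      in this step.\<close>
    have nc: "(i+1, j) \<notin> aztec_cells k c" "(i, j+1) \<notin> aztec_cells k c"
      "(i-1, j) \<notin> aztec_cells k c" "(i, j-1) \<notin> aztec_cells k c"
      by (simp_all only: c aztec_cells_iff e simp_thms)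
    note cf = cell_faces[OF f[unfolded ij]]
    note x' = same[OF cf(3) nc(1)] same[OF cf(4) nc(2)] same[OF cf(5) nc(3)] same[OF cf(6) nc(4)]
    \<comment> \<open>The two faces that define the gauge at a corner are the neighbours of the cell
      that meet there.\<close>
    have h: "h (i, j) = m * (x (i, j-1) - x (i-1, j))" "h (i+1, j) = m * (x (i, j-1) - x (i+1, j))"
      "h (i+1, j+1) = m * (x (i+1, j) - x (i, j+1))" "h (i, j+1) = m * (x (i-1, j) - x (i, j+1))"
      by (simp_all only: h_def noncell_faces_def c fst_conv snd_conv e diagonal_faces.simps if_True if_False
          add_diff_cancel_right')
    define sa sb sc sd where s_defs: "sa = \<phi> ((i+1, j+1), (i+1, j))" "sb = \<phi> ((i, j+1), (i+1, j+1))"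
      "sc = \<phi> ((i, j), (i, j+1))" "sd = \<phi> ((i+1, j), (i, j))"
    note opp = signs(6-9)[folded s_defs]
    \<comment> \<open>The two darts on a side have opposite signs and see the cell and its neighbour
      on their right.\<close>
    have old: "sd * (x (i, j) - x (i, j-1)) = ?wt ((i, j), (i+1, j)) + ?wt ((i+1, j), (i, j))"
      "sa * (x (i, j) - x (i+1, j)) = ?wt ((i+1, j), (i+1, j+1)) + ?wt ((i+1, j+1), (i+1, j))"
      "sb * (x (i, j) - x (i, j+1)) = ?wt ((i+1, j+1), (i, j+1)) + ?wt ((i, j+1), (i+1, j+1))"
      "sc * (x (i, j) - x (i-1, j)) = ?wt ((i, j+1), (i, j)) + ?wt ((i, j), (i, j+1))"
      by (simp_all add: opp s_defs[symmetric] right_diff_distrib)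
    have new: "sd * (x' (i, j) - x (i, j-1)) = ?wt' ((i, j), (i+1, j)) + ?wt' ((i+1, j), (i, j))"
      "- sa * (x' (i, j) - x (i+1, j)) = ?wt' ((i+1, j), (i+1, j+1)) + ?wt' ((i+1, j+1), (i+1, j))"
      "sb * (x' (i, j) - x (i, j+1)) = ?wt' ((i+1, j+1), (i, j+1)) + ?wt' ((i, j+1), (i+1, j+1))"
      "- sc * (x' (i, j) - x (i-1, j)) = ?wt' ((i, j+1), (i, j)) + ?wt' ((i, j), (i, j+1))"
      by (simp_all add: flip_vertical_def opp s_defs[symmetric] x' right_diff_distrib)
    have rel:
      "sd * (x (i, j) - x (i, j-1)) * (sb * (x (i, j) - x (i, j+1))) + sa * (x (i, j) - x (i+1, j)) * (sc * (x (i, j) - x (i-1, j))) = \<kappa> (i, j)"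
      "sb * (x (i, j) - x (i, j+1)) * (h (i, j) * h (i+1, j)) = \<kappa> (i, j) * (sd * (x' (i, j) - x (i, j-1)))"
      "sc * (x (i, j) - x (i-1, j)) * (h (i+1, j) * h (i+1, j+1)) = \<kappa> (i, j) * (- sa * (x' (i, j) - x (i+1, j)))"
      "sd * (x (i, j) - x (i, j-1)) * (h (i+1, j+1) * h (i, j+1)) = \<kappa> (i, j) * (sb * (x' (i, j) - x (i, j+1)))"
      "sa * (x (i, j) - x (i+1, j)) * (h (i, j) * h (i, j+1)) = \<kappa> (i, j) * (- sc * (x' (i, j) - x (i-1, j)))"
      "h (i, j) * (h (i+1, j) * (h (i+1, j+1) * h (i, j+1))) = \<kappa> (i, j) * (sd * (x' (i, j) - x (i, j-1)) * (sb * (x' (i, j) - x (i, j+1))) + - sa * (x' (i, j) - x (i+1, j)) * (- sc * (x' (i, j) - x (i-1, j))))"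
      unfolding h \<kappa> s_defs by (rule wts)+
    have "distinct [(i, j), (i+1, j), (i+1, j+1), (i, j+1)]" by simp
    from matching_sum_square_relation[OF this face_darts_cyclic old new rel s[unfolded ij corners_cyclic]]
    have "matching_sum (face_darts f) ?wt ({(i, j), (i+1, j), (i+1, j+1), (i, j+1)} - s) * (\<Prod>v\<in>s. h v) =
      \<kappa> (i, j) * matching_sum (face_darts f) ?wt' s"
      unfolding ij .
    then show ?thesis unfolding ij corners_cyclic .
  qed
  have "matching_sum (\<Union>f\<in>aztec_cells k c. face_darts f) ?wt (aztec_vertices (Suc k) c) *
      (\<Prod>v\<in>aztec_vertices k c. h v) =
      (\<Prod>f\<in>aztec_cells k c. \<kappa> f) *
      matching_sum (\<Union>f\<in>aztec_cells k c. face_darts f) ?wt' (aztec_vertices k c)"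
  proof (rule matching_sum_complement[where K = corners])
    show "finite (corners f)" for f by (cases f) simp
  qed (use cell face_darts_ends in \<open>simp_all add: finite_aztec_cells finite_face_darts
      disjoint_face_darts_cells card_corner_cells\<close>)
  then show ?thesis
    unfolding matching_sum_aztec_cells
    by (simp add: dimer_Z_eq_matching_sum aztec_darts_eq_cells)
qed

text \<open>All powers of \<open>wedge p L\<close> in one step, with \<open>y\<close> and
  \<open>y'\<close> the old and new factors. A cell contributes \<open>y f\<close> and
  \<open>y' f\<close> once to each side. At any other face the exponents agree by
  \<open>card_noncell\<close>; this balance is why the normalising product has exactly one factor
  per face.\<close>

lemma prod_noncells:
  fixes y y' :: "face \<Rightarrow> complex"
  assumes same: "\<And>f. f \<in> aztec_faces (Suc k) c \<Longrightarrow> f \<notin> aztec_cells k c \<Longrightarrow> y' f = y f"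
  shows "(\<Prod>f\<in>aztec_faces (Suc k) c. y f) *
      (\<Prod>v\<in>aztec_vertices k c. y (fst (noncell_faces k c v)) * y (snd (noncell_faces k c v))) *
      (\<Prod>f\<in>aztec_cells k c. y' f) =
    (\<Prod>f\<in>aztec_faces k c. y' f) * (\<Prod>f\<in>aztec_cells k c. y f * (\<Prod>g\<in>neighbours f. y g))"
proof -
  obtain u v where c: "c = (u, v)" by fastforce
  define N where "N = {f \<in> aztec_faces (Suc k) c. odd (fst f + snd f + fst c + snd c + int k)}"
  have N_iff: "(i, j) \<in> N \<longleftrightarrow> \<bar>i - u\<bar> + \<bar>j - v\<bar> \<le> int k + 1 \<and> odd (i + j + u + v + int k)" for i j
    by (simp add: N_def c add.commute)
  have finN: "finite N" by (simp add: N_def finite_aztec_faces)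
  have outer: "aztec_faces (Suc k) c = aztec_cells k c \<union> N"
  proof -
    have "(i, j) \<in> aztec_faces (Suc k) c \<longleftrightarrow> (i, j) \<in> aztec_cells k c \<union> N" for i j
      unfolding c Un_iff aztec_faces_iff aztec_cells_iff N_iff[unfolded c] of_nat_Suc
      using cell_parity[of i j u v k] by linarith
    then show ?thesis by (simp only: set_eq_iff split_paired_All) blast
  qed
  have inner: "aztec_faces k c = aztec_cells k c \<union> {f \<in> N. f \<in> aztec_faces k c}"
  proof -
    have "(i, j) \<in> aztec_faces k c \<longleftrightarrow> (i, j) \<in> aztec_cells k c \<union> {f \<in> N. f \<in> aztec_faces k c}" for i j
      unfolding Un_iff mem_Collect_eq N_iff unfolding c aztec_faces_iff aztec_cells_iff by linarith
    then show ?thesis by (simp only: set_eq_iff split_paired_All) blast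
  qed
  have disj: "aztec_cells k c \<inter> N = {}" by (auto simp: aztec_cells_def N_def)
  have at_vertex: "y (fst (noncell_faces k c x)) * y (snd (noncell_faces k c x)) =
      (\<Prod>f\<in>{f \<in> N. x \<in> corners f}. y f)" if x: "x \<in> aztec_vertices k c" for x
  proof -
    obtain p q where pq: "x = (p, q)" by fastforce
    have le: "\<bar>2 * p - 1 - 2 * u\<bar> + \<bar>2 * q - 1 - 2 * v\<bar> \<le> 2 * int k"
      using x unfolding pq c aztec_vertices_iff .
    then have dist: "\<bar>p - u\<bar> + \<bar>q - v\<bar> \<le> int k + 1" "\<bar>p - 1 - u\<bar> + \<bar>q - v\<bar> \<le> int k + 1"
      "\<bar>p - u\<bar> + \<bar>q - 1 - v\<bar> \<le> int k + 1" "\<bar>p - 1 - u\<bar> + \<bar>q - 1 - v\<bar> \<le> int k + 1"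
      by (cases "p \<ge> u + 1"; cases "q \<ge> v + 1"; simp add: abs_if; presburger?)+
    have at_corner: "{f \<in> N. x \<in> corners f} =
        (if (p, q) \<in> N then {(p, q)} else {}) \<union> (if (p - 1, q) \<in> N then {(p - 1, q)} else {}) \<union>
        (if (p, q - 1) \<in> N then {(p, q - 1)} else {}) \<union> (if (p - 1, q - 1) \<in> N then {(p - 1, q - 1)} else {})"
      by (auto simp: pq corners_iff simp del: corners.simps)
    show ?thesis
    proof (cases "even (p + q + u + v + int k)")
      case True
      then have e: "even (p + q + u + v + int k) = True" "even (p - 1 + q + u + v + int k) = False"
        "even (p + (q - 1) + u + v + int k) = False" "even (p - 1 + (q - 1) + u + v + int k) = True"
        by presburger+
      have "(p, q - 1) \<in> N" "(p - 1, q) \<in> N" "(p, q) \<notin> N" "(p - 1, q - 1) \<notin> N"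
        by (simp_all only: N_iff e dist simp_thms)
      then have "{f \<in> N. x \<in> corners f} = {(p, q - 1), (p - 1, q)}"
        unfolding at_corner by (simp_all add: insert_commute)
      then show ?thesis using True by (simp add: noncell_faces_def pq c)
    next
      case False
      then have e: "even (p + q + u + v + int k) = False" "even (p - 1 + q + u + v + int k) = True"
        "even (p + (q - 1) + u + v + int k) = True" "even (p - 1 + (q - 1) + u + v + int k) = False"
        by presburger+
      have "(p - 1, q - 1) \<in> N" "(p, q) \<in> N" "(p, q - 1) \<notin> N" "(p - 1, q) \<notin> N"
        by (simp_all only: N_iff e dist simp_thms)
      then have "{f \<in> N. x \<in> corners f} = {(p - 1, q - 1), (p, q)}"
        unfolding at_corner by (simp_all add: insert_commute)
      then show ?thesis using False by (simp add: noncell_faces_def pq c)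
    qed
  qed
  have nbs: "neighbours f = {g \<in> N. g \<in> neighbours f}" if f: "f \<in> aztec_cells k c" for f
  proof -
    obtain i j where ij: "f = (i, j)" by fastforce
    have f': "\<bar>i - u\<bar> + \<bar>j - v\<bar> \<le> int k" "even (i + j + u + v + int k)"
      using f by (simp_all only: ij c aztec_cells_iff)
    have e: "odd (i + 1 + j + u + v + int k)" "odd (i + (j + 1) + u + v + int k)"
      "odd (i - 1 + j + u + v + int k)" "odd (i + (j - 1) + u + v + int k)"
      using f'(2) by presburger+
    have "\<bar>x + 1 - y\<bar> \<le> \<bar>x - y\<bar> + 1" "\<bar>x - 1 - y\<bar> \<le> \<bar>x - y\<bar> + 1" for x y :: int by linarith+
    note dist = add_mono[OF this(1) order_refl] add_mono[OF this(2) order_refl]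
      add_mono[OF order_refl this(1)] add_mono[OF order_refl this(2)]
    have "(i+1, j) \<in> N" "(i, j+1) \<in> N" "(i-1, j) \<in> N" "(i, j-1) \<in> N"
      unfolding N_iff using e f'(1)
      by (auto intro: order_trans[OF dist(1)] order_trans[OF dist(2)] order_trans[OF dist(3)] order_trans[OF dist(4)])
    then show ?thesis unfolding ij neighbours_def by auto
  qed
  have "(\<Prod>v\<in>aztec_vertices k c. y (fst (noncell_faces k c v)) * y (snd (noncell_faces k c v))) =
      (\<Prod>x\<in>aztec_vertices k c. \<Prod>f\<in>{f \<in> N. x \<in> corners f}. y f)"
    by (rule prod.cong[OF refl at_vertex])
  also have "\<dots> = (\<Prod>f\<in>N. \<Prod>x\<in>{x \<in> aztec_vertices k c. x \<in> corners f}. y f)"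
    by (rule prod.swap_restrict[OF finite_aztec_vertices finN])
  finally have verts: "(\<Prod>v\<in>aztec_vertices k c. y (fst (noncell_faces k c v)) * y (snd (noncell_faces k c v))) =
      (\<Prod>f\<in>N. y f ^ card {x \<in> aztec_vertices k c. x \<in> corners f})"
    by (simp only: prod_constant)
  have "(\<Prod>f\<in>aztec_cells k c. \<Prod>g\<in>neighbours f. y g) =
      (\<Prod>f\<in>aztec_cells k c. \<Prod>g\<in>{g \<in> N. g \<in> neighbours f}. y g)"
    using nbs by (intro prod.cong) simp_all
  also have "\<dots> = (\<Prod>g\<in>N. \<Prod>f\<in>{f \<in> aztec_cells k c. g \<in> neighbours f}. y g)"
    by (rule prod.swap_restrict[OF finite_aztec_cells finN])
  finally have cells: "(\<Prod>f\<in>aztec_cells k c. \<Prod>g\<in>neighbours f. y g) =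
      (\<Prod>g\<in>N. y g ^ card {f \<in> aztec_cells k c. g \<in> neighbours f})"
    by (simp only: prod_constant)
  have "(\<Prod>f\<in>N. y f) * (\<Prod>f\<in>N. y f ^ card {x \<in> aztec_vertices k c. x \<in> corners f}) =
      (\<Prod>f\<in>N. y f ^ (card {x \<in> aztec_vertices k c. x \<in> corners f} + 1))"
    by (simp add: prod.distrib)
  also have "\<dots> = (\<Prod>f\<in>N. y f ^ (card {g \<in> aztec_cells k c. f \<in> neighbours g} + of_bool (f \<in> aztec_faces k c)))"
  proof (rule prod.cong[OF refl])
    fix f assume "f \<in> N"
    then have "f \<in> aztec_faces (Suc k) c" "odd (fst f + snd f + fst c + snd c + int k)"
      unfolding N_def by simp_all
    from card_noncell[OF this] show "y f ^ (card {x \<in> aztec_vertices k c. x \<in> corners f} + 1) =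
        y f ^ (card {g \<in> aztec_cells k c. f \<in> neighbours g} + of_bool (f \<in> aztec_faces k c))"
      by (simp only:)
  qed
  also have "\<dots> = (\<Prod>f\<in>N. y f ^ card {g \<in> aztec_cells k c. f \<in> neighbours g}) *
      (\<Prod>f\<in>N. if f \<in> aztec_faces k c then y f else 1)"
    by (simp add: power_add prod.distrib of_bool_def if_distrib[of "power _"] cong: if_cong)
  also have "(\<Prod>f\<in>N. if f \<in> aztec_faces k c then y f else 1) = (\<Prod>f\<in>{f \<in> N. f \<in> aztec_faces k c}. y f)"
    by (rule prod.inter_filter[OF finN, symmetric])
  also have "\<dots> = (\<Prod>f\<in>{f \<in> N. f \<in> aztec_faces k c}. y' f)"
    using disj by (intro prod.cong refl same[symmetric]) (auto simp: N_def)
  finally have N: "(\<Prod>f\<in>N. y f) * (\<Prod>f\<in>N. y f ^ card {x \<in> aztec_vertices k c. x \<in> corners f}) =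
      (\<Prod>f\<in>N. y f ^ card {g \<in> aztec_cells k c. f \<in> neighbours g}) * (\<Prod>f\<in>{f \<in> N. f \<in> aztec_faces k c}. y' f)" .
  have "(\<Prod>f\<in>aztec_faces (Suc k) c. y f) = (\<Prod>f\<in>aztec_cells k c. y f) * (\<Prod>f\<in>N. y f)"
    unfolding outer by (rule prod.union_disjoint[OF finite_aztec_cells finN disj])
  moreover have "(\<Prod>f\<in>aztec_faces k c. y' f) =
      (\<Prod>f\<in>aztec_cells k c. y' f) * (\<Prod>f\<in>{f \<in> N. f \<in> aztec_faces k c}. y' f)"
    by (subst inner, rule prod.union_disjoint) (use finN disj in \<open>auto simp: finite_aztec_cells\<close>)
  moreover have "(\<Prod>f\<in>aztec_cells k c. y f * (\<Prod>g\<in>neighbours f. y g)) =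
      (\<Prod>f\<in>aztec_cells k c. y f) * (\<Prod>g\<in>N. y g ^ card {f \<in> aztec_cells k c. g \<in> neighbours f})"
    by (simp only: prod.distrib cells)
  moreover have "a * b * w * a' = a' * d * (a * q)" if "b * w = q * d" for a b w a' d q :: complex
    using that by algebra
  ultimately show ?thesis
    using N by (simp only: verts)
qed

section \<open>Homogeneous coordinates and charts\<close>

definition wedge :: "complex \<times> complex \<Rightarrow> complex \<times> complex \<Rightarrow> complex" where
  "wedge p q = fst p * snd q - snd p * fst q"

definition chart :: "complex \<times> complex \<Rightarrow> complex \<times> complex \<Rightarrow> complex \<times> complex \<Rightarrow> complex" where
  "chart L M p = wedge p M / wedge p L"

text \<open>The numerator is the three-term Pluecker relation. A chart thus enters differences only
  through one factor per point and a global constant.\<close>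

lemma chart_diff:
  assumes "wedge p L \<noteq> 0" "wedge q L \<noteq> 0"
  shows "chart L M p - chart L M q = wedge M L * (wedge p q / (wedge p L * wedge q L))"
proof -
  have "wedge p M * wedge q L - wedge q M * wedge p L = wedge M L * wedge p q"
    by (simp add: wedge_def algebra_simps)
  then show ?thesis using assms by (simp add: chart_def divide_simps)
qed

text \<open>The dSKP equation says that the new point is proportional to this vector, where \<open>X\<close> is the old
  point and \<open>a, b, c, d\<close> are its east, north, west and south neighbours.\<close>

definition dskp_vector ::
  "complex \<times> complex \<Rightarrow> complex \<times> complex \<Rightarrow> complex \<times> complex \<Rightarrow> complex \<times> complex \<Rightarrow>
   complex \<times> complex \<Rightarrow> complex \<times> complex" where
  "dskp_vector X a b c d =
     (wedge X b * wedge c d * fst a + wedge X c * wedge a b * fst d,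
      wedge X b * wedge c d * snd a + wedge X c * wedge a b * snd d)"

lemma wedge_dskp_vector: "wedge (dskp_vector X a b c d) L = wedge X b * wedge c d * wedge a L + wedge X c * wedge a b * wedge d L"
  by (simp add: dskp_vector_def wedge_def algebra_simps)

text \<open>The quantity \<delta> of \<open>square_weights\<close> in a chart, cleared of
  denominators. It produces the factor \<open>wedge X' L\<close> of the new point, up to a scale
  that does not involve \<open>L\<close>.\<close>

lemma dskp_discriminant:
  "wedge X b * wedge X d * (wedge a L * wedge c L) - wedge X a * wedge X c * (wedge b L * wedge d L) =
    wedge X L * wedge (dskp_vector X a b c d) L"
  unfolding dskp_vector_def wedge_def fst_conv snd_conv by algebra

lemma parallel_scalar:
  assumes "wedge p q = 0" "p \<noteq> (0, 0)"
  obtains r where "\<And>L. wedge q L = r * wedge p L"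
proof -
  obtain p1 p2 q1 q2 where pq: "p = (p1, p2)" "q = (q1, q2)" by fastforce
  consider "p1 \<noteq> 0" | "p2 \<noteq> 0" using assms(2) pq by auto
  then show ?thesis
  proof cases
    case 1
    then have "q2 = (q1 / p1) * p2" "q1 = (q1 / p1) * p1" using assms(1) by (simp_all add: pq wedge_def field_simps)
    then have "wedge q L = (q1 / p1) * wedge p L" for L unfolding pq wedge_def fst_conv snd_conv
      by (metis (no_types, lifting) mult.assoc right_diff_distrib)
    then show ?thesis by (rule that)
  next
    case 2
    then have "q1 = (q2 / p2) * p1" "q2 = (q2 / p2) * p2" using assms(1) by (simp_all add: pq wedge_def field_simps)
    then have "wedge q L = (q2 / p2) * wedge p L" for L unfolding pq wedge_def fst_conv snd_conv
      by (metis (no_types, lifting) mult.assoc right_diff_distrib)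
    then show ?thesis by (rule that)
  qed
qed

text \<open>A vertex of the smaller diamond has a cell on its left, below or above it. The two faces
  of the gauge are consecutive neighbours of that cell, so the hypotheses about neighbours of cells
  apply to them.\<close>

lemma vertex_cell:
  assumes v: "x \<in> aztec_vertices k c"
  obtains i j where "(i, j) \<in> aztec_cells k c" "noncell_faces k c x = ((i+1, j), (i, j+1))"
  | i j where "(i, j) \<in> aztec_cells k c" "noncell_faces k c x = ((i, j-1), (i+1, j))"
proof -
  obtain p q u v where pq: "x = (p, q)" and c: "c = (u, v)" by fastforce
  have le: "\<bar>2 * p - 1 - 2 * u\<bar> + \<bar>2 * q - 1 - 2 * v\<bar> \<le> 2 * int k"
    using v unfolding pq c aztec_vertices_iff .
  then have dist: "\<bar>p - 1 - u\<bar> + \<bar>q - v\<bar> \<le> int k + 1" "\<bar>p - 1 - u\<bar> + \<bar>q - 1 - v\<bar> \<le> int k + 1"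
    by (cases "p \<ge> u + 1"; cases "q \<ge> v + 1"; simp add: abs_if; presburger?)+
  show ?thesis
  proof (cases "even (p + q + u + v + int k)")
    case True
    then have e: "even ((p - 1) + (q - 1) + u + v + int k)" by presburger
    have "(p - 1, q - 1) \<in> aztec_cells k c"
      using e cell_parity[OF e] dist(2) unfolding c aztec_cells_iff by linarith
    moreover have "noncell_faces k c x = ((p - 1 + 1, q - 1), (p - 1, q - 1 + 1))"
      using True by (simp add: noncell_faces_def pq c)
    ultimately show ?thesis by (rule that(1))
  next
    case False
    then have e: "even ((p - 1) + q + u + v + int k)" by presburger
    have "(p - 1, q) \<in> aztec_cells k c"
      using e cell_parity[OF e] dist(1) unfolding c aztec_cells_iff by linarith
    moreover have "noncell_faces k c x = ((p - 1, q - 1), (p - 1 + 1, q))"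
      using False by (simp add: noncell_faces_def pq c)
    ultimately show ?thesis by (rule that(2))
  qed
qed

lemma noncell_faces_in:
  assumes v: "x \<in> aztec_vertices k c"
  shows "fst (noncell_faces k c x) \<in> aztec_faces (Suc k) c" "snd (noncell_faces k c x) \<in> aztec_faces (Suc k) c"
  using v by (rule vertex_cell; simp add: cell_faces)+

lemma wedge_swap: "wedge q p = - wedge p q"
  by (simp add: wedge_def)

text \<open>Each of the six points occurs once on either side, so both sides acquire the same
  denominator, and the same power of \<open>m\<close>.\<close>

lemma dskp_chart:
  assumes "wedge X' (dskp_vector X a b c d) = 0"
  shows "m * (wedge X' a / (y' * ya)) * (m * (wedge X b / (y * yb))) * (m * (wedge c d / (yc * yd))) =
    - (m * (wedge X' d / (y' * yd))) * (m * (wedge X c / (y * yc))) * (m * (wedge a b / (ya * yb)))"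
proof -
  have "wedge (dskp_vector X a b c d) X' = 0" using assms wedge_swap[of "dskp_vector X a b c d" X'] by simp
  then have "wedge X' a * wedge X b * wedge c d = - (wedge X' d * wedge X c * wedge a b)"
    unfolding wedge_dskp_vector using wedge_swap[of a X'] wedge_swap[of d X'] by algebra
  then have "m^3 * (wedge X' a * wedge X b * wedge c d) / (y' * y * ya * yb * yc * yd) =
      m^3 * - (wedge X' d * wedge X c * wedge a b) / (y' * y * ya * yb * yc * yd)" by simp
  then show ?thesis by (simp add: power3_eq_cube mult_ac)
qed

lemma discriminant_chart:
  fixes m y ya yb yc yd p q r s w :: complex
  assumes "q * s * (ya * yc) - p * r * (yb * yd) = y * w" "m * m = 1"
    and "y \<noteq> 0" "ya \<noteq> 0" "yb \<noteq> 0" "yc \<noteq> 0" "yd \<noteq> 0"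
  shows "m * (q / (y * yb)) * (m * (s / (y * yd))) - m * (p / (y * ya)) * (m * (r / (y * yc))) =
    w / (y * (ya * yb * yc * yd))"
proof -
  have "m * (q / (y * yb)) * (m * (s / (y * yd))) - m * (p / (y * ya)) * (m * (r / (y * yc))) =
    (m * m) * ((q * s * (ya * yc) - p * r * (yb * yd)) / (y * y * (ya * yb * yc * yd)))"
    using assms(3-) by (simp add: divide_simps) (simp add: algebra_simps)
  also have "\<dots> = w / (y * (ya * yb * yc * yd))" unfolding assms(1,2) using assms(3-) by simp
  finally show ?thesis .
qed

text \<open>The normalising products absorb every factor \<open>wedge p L\<close> that the
  differences leave behind. Hence \<open>C\<close> can be chosen before \<open>L\<close> and
  \<open>M\<close>, and the later limit relies on this order of quantifiers.\<close>

lemma dimer_Z_homogeneous_step: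
  fixes X X' :: "face \<Rightarrow> complex \<times> complex"
  assumes kast: "kasteleyn_orientation (Suc k) c \<phi>"
    and same: "\<And>f. f \<in> aztec_faces (Suc k) c \<Longrightarrow> f \<notin> aztec_cells k c \<Longrightarrow> X' f = X f"
    and dskp: "\<And>i j. (i, j) \<in> aztec_cells k c \<Longrightarrow>
      wedge (X' (i, j)) (dskp_vector (X (i, j)) (X (i+1, j)) (X (i, j+1)) (X (i-1, j)) (X (i, j-1))) = 0"
    and ne: "\<And>i j. (i, j) \<in> aztec_cells k c \<Longrightarrow>
      wedge (X (i+1, j)) (X (i, j+1)) \<noteq> 0 \<and> wedge (X (i, j+1)) (X (i-1, j)) \<noteq> 0 \<and>
      wedge (X (i-1, j)) (X (i, j-1)) \<noteq> 0 \<and> wedge (X (i, j-1)) (X (i+1, j)) \<noteq> 0"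
    and nz: "\<And>f. f \<in> aztec_cells k c \<Longrightarrow> X' f \<noteq> (0, 0)"
  shows "\<exists>C. \<forall>L M. wedge M L * wedge M L = 1 \<longrightarrow> (\<forall>f\<in>aztec_faces (Suc k) c. wedge (X f) L \<noteq> 0) \<longrightarrow>
    (\<forall>f\<in>aztec_faces k c. wedge (X' f) L \<noteq> 0) \<longrightarrow>
    (\<Prod>f\<in>aztec_faces (Suc k) c. wedge (X f) L) * dimer_Z (Suc k) c \<phi> (\<lambda>f. chart L M (X f)) =
    C * ((\<Prod>f\<in>aztec_faces k c. wedge (X' f) L) * dimer_Z k c (flip_vertical \<phi>) (\<lambda>f. chart L M (X' f)))"
proof -
  let ?W = "\<lambda>f. dskp_vector (X f) (X (fst f + 1, snd f)) (X (fst f, snd f + 1)) (X (fst f - 1, snd f)) (X (fst f, snd f - 1))"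
  let ?n1 = "\<lambda>v. fst (noncell_faces k c v)" and ?n2 = "\<lambda>v. snd (noncell_faces k c v)"
  let ?g = "\<lambda>v. wedge (X (?n1 v)) (X (?n2 v))"
  have "\<exists>r. \<forall>L. wedge (?W f) L = r * wedge (X' f) L" if f: "f \<in> aztec_cells k c" for f
  proof -
    have "wedge (X' f) (?W f) = 0" using dskp[of "fst f" "snd f"] f by simp
    from parallel_scalar[OF this nz[OF f]] show ?thesis by metis
  qed
  \<comment> \<open>The scale between \<open>dskp_vector\<close> and the given lift of the new
    point, independent of \<open>L\<close>.\<close>
  then obtain \<rho> where \<rho>: "\<And>f L. f \<in> aztec_cells k c \<Longrightarrow> wedge (?W f) L = \<rho> f * wedge (X' f) L"
    by metis
  \<comment> \<open>What remains of the cell factors and of the gauge in \<open>dimer_Z_step\<close>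
    once all factors \<open>wedge p L\<close> are split off.\<close>
  define C where "C = (\<Prod>f\<in>aztec_cells k c. - cell_sign \<phi> f * \<rho> f) / (\<Prod>v\<in>aztec_vertices k c. ?g v)"
  have "(\<Prod>f\<in>aztec_faces (Suc k) c. wedge (X f) L) * dimer_Z (Suc k) c \<phi> (\<lambda>f. chart L M (X f)) =
    C * ((\<Prod>f\<in>aztec_faces k c. wedge (X' f) L) * dimer_Z k c (flip_vertical \<phi>) (\<lambda>f. chart L M (X' f)))"
    if m_sq: "wedge M L * wedge M L = 1" and y: "\<forall>f\<in>aztec_faces (Suc k) c. wedge (X f) L \<noteq> 0"
      and y': "\<forall>f\<in>aztec_faces k c. wedge (X' f) L \<noteq> 0" for L M
  proof -
    define y where "y = (\<lambda>f. wedge (X f) L)"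
    define y' where "y' = (\<lambda>f. wedge (X' f) L)"
    define x where "x = (\<lambda>f. chart L M (X f))"
    define x' where "x' = (\<lambda>f. chart L M (X' f))"
    define m where "m = wedge M L"
    have y_ne: "y f \<noteq> 0" if "f \<in> aztec_faces (Suc k) c" for f using y that by (simp add: y_def)
    have y'_ne: "y' f \<noteq> 0" if "f \<in> aztec_faces k c" for f using y' that by (simp add: y'_def)
    have diff: "x f - x g = m * (wedge (X f) (X g) / (y f * y g))"
      if "f \<in> aztec_faces (Suc k) c" "g \<in> aztec_faces (Suc k) c" for f g
      using chart_diff[of "X f" L "X g" M] y_ne[OF that(1)] y_ne[OF that(2)]
      by (simp add: x_def y_def m_def)
    have diff': "x' f - x g = m * (wedge (X' f) (X g) / (y' f * y g))"
      if "f \<in> aztec_faces k c" "g \<in> aztec_faces (Suc k) c" for f g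
      using chart_diff[of "X' f" L "X g" M] y'_ne[OF that(1)] y_ne[OF that(2)]
      by (simp add: x_def x'_def y_def y'_def m_def)
    have mm: "m * m = 1" using m_sq by (simp add: m_def)
    then have m0: "m \<noteq> 0" by auto
    have dskp': "(x' (i, j) - x (i+1, j)) * (x (i, j) - x (i, j+1)) * (x (i-1, j) - x (i, j-1)) =
        - (x' (i, j) - x (i, j-1)) * (x (i, j) - x (i-1, j)) * (x (i+1, j) - x (i, j+1))"
      if f: "(i, j) \<in> aztec_cells k c" for i j
      unfolding diff[OF cell_faces(2,3)[OF f]] diff[OF cell_faces(2,4)[OF f]] diff[OF cell_faces(5,6)[OF f]]
        diff[OF cell_faces(2,5)[OF f]] diff[OF cell_faces(3,4)[OF f]] 
        diff'[OF cell_faces(1,3)[OF f]] diff'[OF cell_faces(1,6)[OF f]] diff'[OF cell_faces(1,4)[OF f]]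
      using dskp[OF f] by (rule dskp_chart)
    have ne': "x (i+1, j) \<noteq> x (i, j+1) \<and> x (i, j+1) \<noteq> x (i-1, j) \<and>
        x (i-1, j) \<noteq> x (i, j-1) \<and> x (i, j-1) \<noteq> x (i+1, j)"
      if f: "(i, j) \<in> aztec_cells k c" for i j
    proof -
      have "x (i+1, j) - x (i, j+1) \<noteq> 0" "x (i, j+1) - x (i-1, j) \<noteq> 0" "x (i-1, j) - x (i, j-1) \<noteq> 0"
        "x (i, j-1) - x (i+1, j) \<noteq> 0"
        unfolding diff[OF cell_faces(3,4)[OF f]] diff[OF cell_faces(4,5)[OF f]] diff[OF cell_faces(5,6)[OF f]]
          diff[OF cell_faces(6,3)[OF f]]
        using ne[OF f] y_ne[OF cell_faces(3)[OF f]] y_ne[OF cell_faces(4)[OF f]] y_ne[OF cell_faces(5)[OF f]]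
          y_ne[OF cell_faces(6)[OF f]] m0
        by simp_all
      then show ?thesis by auto
    qed
    have same_x: "x' f = x f" and same_y: "y' f = y f" if "f \<in> aztec_faces (Suc k) c" "f \<notin> aztec_cells k c" for f
      using same[OF that] by (simp_all add: x_def x'_def y_def y'_def)
    let ?PG = "\<Prod>v\<in>aztec_vertices k c. ?g v" and ?PV = "\<Prod>v\<in>aztec_vertices k c. y (?n1 v) * y (?n2 v)"
    let ?S = "\<Prod>f\<in>aztec_cells k c. - cell_sign \<phi> f * \<rho> f"
    let ?PQ = "\<Prod>f\<in>aztec_cells k c. y f * (\<Prod>g\<in>neighbours f. y g)"
    have "(\<Prod>v\<in>aztec_vertices k c. m * (x (?n1 v) - x (?n2 v))) =
        (\<Prod>v\<in>aztec_vertices k c. ?g v / (y (?n1 v) * y (?n2 v)))"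
    proof (rule prod.cong[OF refl])
      fix v assume v: "v \<in> aztec_vertices k c"
      show "m * (x (?n1 v) - x (?n2 v)) = ?g v / (y (?n1 v) * y (?n2 v))"
        unfolding diff[OF noncell_faces_in[OF v]] using mm by (simp add: mult.assoc[symmetric])
    qed
    then have hprod: "(\<Prod>v\<in>aztec_vertices k c. m * (x (?n1 v) - x (?n2 v))) = ?PG / ?PV"
      by (simp only: prod_dividef)
    have "(\<Prod>f\<in>aztec_cells k c. - cell_sign \<phi> f * ((x f - x (fst f, snd f + 1)) * (x f - x (fst f, snd f - 1)) -
        (x f - x (fst f + 1, snd f)) * (x f - x (fst f - 1, snd f)))) =
      (\<Prod>f\<in>aztec_cells k c. (- cell_sign \<phi> f * \<rho> f) * y' f / (y f * (\<Prod>g\<in>neighbours f. y g)))"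
    proof (rule prod.cong[OF refl])
      fix f assume f: "f \<in> aztec_cells k c"
      obtain i j where ij: "f = (i, j)" by fastforce
      note F = cell_faces[OF f[unfolded ij]]
      have disc: "wedge (X (i, j)) (X (i, j+1)) * wedge (X (i, j)) (X (i, j-1)) * (y (i+1, j) * y (i-1, j)) -
          wedge (X (i, j)) (X (i+1, j)) * wedge (X (i, j)) (X (i-1, j)) * (y (i, j+1) * y (i, j-1)) =
          y (i, j) * (\<rho> (i, j) * y' (i, j))"
        using dskp_discriminant \<rho>[OF f, of L] unfolding y_def y'_def ij fst_conv snd_conv by metis
      have nb: "(\<Prod>g\<in>neighbours f. y g) = y (i+1, j) * y (i, j+1) * y (i-1, j) * y (i, j-1)"
        by (simp add: neighbours_def ij)
      have "(x (i, j) - x (i, j+1)) * (x (i, j) - x (i, j-1)) - (x (i, j) - x (i+1, j)) * (x (i, j) - x (i-1, j)) =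
          \<rho> (i, j) * y' (i, j) / (y (i, j) * (y (i+1, j) * y (i, j+1) * y (i-1, j) * y (i, j-1)))"
        unfolding diff[OF F(2,3)] diff[OF F(2,4)] diff[OF F(2,5)] diff[OF F(2,6)]
        by (rule discriminant_chart[OF disc mm y_ne[OF F(2)] y_ne[OF F(3)] y_ne[OF F(4)] y_ne[OF F(5)] y_ne[OF F(6)]])
      then show "- cell_sign \<phi> f * ((x f - x (fst f, snd f + 1)) * (x f - x (fst f, snd f - 1)) -
        (x f - x (fst f + 1, snd f)) * (x f - x (fst f - 1, snd f))) =
        (- cell_sign \<phi> f * \<rho> f) * y' f / (y f * (\<Prod>g\<in>neighbours f. y g))"
        unfolding nb unfolding ij fst_conv snd_conv by (simp only: mult.assoc times_divide_eq_right)
    qed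
    then have \<kappa>prod: "(\<Prod>f\<in>aztec_cells k c. - cell_sign \<phi> f * ((x f - x (fst f, snd f + 1)) * (x f - x (fst f, snd f - 1)) -
        (x f - x (fst f + 1, snd f)) * (x f - x (fst f - 1, snd f)))) =
        ?S * (\<Prod>f\<in>aztec_cells k c. y' f) / ?PQ"
      by (simp only: prod_dividef prod.distrib)
    have step: "dimer_Z (Suc k) c \<phi> x * (?PG / ?PV) =
        ?S * (\<Prod>f\<in>aztec_cells k c. y' f) / ?PQ * dimer_Z k c (flip_vertical \<phi>) x'"
      using dimer_Z_step[OF kast mm same_x dskp' ne'] unfolding hprod \<kappa>prod .
    have count: "(\<Prod>f\<in>aztec_faces (Suc k) c. y f) * ?PV * (\<Prod>f\<in>aztec_cells k c. y' f) =
        (\<Prod>f\<in>aztec_faces k c. y' f) * ?PQ"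
      by (rule prod_noncells[OF same_y])
    have PV: "?PV \<noteq> 0" 
      using noncell_faces_in y_ne by (simp add: prod_zero_iff[OF finite_aztec_vertices])
    have PG: "?PG \<noteq> 0"
    proof -
      have "?g v \<noteq> 0" if v: "v \<in> aztec_vertices k c" for v
        using v
      proof (rule vertex_cell)
        fix i j assume "(i, j) \<in> aztec_cells k c" "noncell_faces k c v = ((i+1, j), (i, j+1))"
        then show ?thesis using ne by simp
      next
        fix i j assume "(i, j) \<in> aztec_cells k c" "noncell_faces k c v = ((i, j-1), (i+1, j))"
        then show ?thesis using ne by simp
      qed
      then show ?thesis by (simp add: prod_zero_iff[OF finite_aztec_vertices])
    qed
    have PQ: "?PQ \<noteq> 0"
    proof -
      have "y f * (\<Prod>g\<in>neighbours f. y g) \<noteq> 0" if f: "f \<in> aztec_cells k c" for f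
      proof -
        obtain i j where ij: "f = (i, j)" by fastforce
        note F = cell_faces[OF f[unfolded ij]]
        show ?thesis unfolding ij using F(2-6)[THEN y_ne] by (simp add: neighbours_def)
      qed
      then show ?thesis by (simp only: prod_zero_iff[OF finite_aztec_cells] bex_simps) blast
    qed
    \<comment> \<open>Combines \<open>step\<close> with the balance of powers in
      \<open>count\<close>; the products \<open>?PV\<close>, \<open>?PG\<close> and
      \<open>?PQ\<close> may be cancelled.\<close>
    have "a * z = s / g * (b * z')" if "z * (g / w) = s * p / q * z'" "a * w * p = b * q" "w \<noteq> 0" "g \<noteq> 0" "q \<noteq> 0"
      for a z s g b z' w p q :: complex
    proof -
      have "z * g * q = s * p * w * z'" using that(1,3-5) by (simp add: field_simps)
      then have "(a * z * g) * q = (s * b * z') * q" using that(2) by algebra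
      then show ?thesis using that(4,5) by (simp add: field_simps)
    qed
    from this[OF step count PV PG PQ] show ?thesis
      by (simp only: C_def x_def x'_def y_def y'_def)
  qed
  then show ?thesis by (intro exI[of _ C] allI impI)
qed

section \<open>Solutions of the dSKP equation\<close>

lemma right_face_in:
  assumes "e \<in> aztec_darts k c"
  shows "right_face e \<in> aztec_faces k c"
proof -
  obtain i j where f: "(i, j) \<in> internal_faces k c" and e: "e \<in> face_darts (i, j)"
    using assms unfolding aztec_darts_def by force
  obtain u v where c: "c = (u, v)" by fastforce
  have le: "\<bar>i - u\<bar> + \<bar>j - v\<bar> < int k" using f by (simp add: c)
  have "\<bar>i + 1 - u\<bar> \<le> \<bar>i - u\<bar> + 1" "\<bar>i - 1 - u\<bar> \<le> \<bar>i - u\<bar> + 1"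
    "\<bar>j + 1 - v\<bar> \<le> \<bar>j - v\<bar> + 1" "\<bar>j - 1 - v\<bar> \<le> \<bar>j - v\<bar> + 1" by linarith+
  with le have "{(i, j), (i+1, j), (i, j+1), (i-1, j), (i, j-1)} \<subseteq> aztec_faces k c"
    by (simp add: c)
  moreover have "right_face e \<in> {(i, j), (i+1, j), (i, j+1), (i-1, j), (i, j-1)}"
    using e unfolding face_darts_cyclic by auto
  ultimately show ?thesis by blast
qed

lemma oriented_dimers_subset: "M \<in> oriented_dimers k c \<Longrightarrow> M \<subseteq> aztec_darts k c"
  by (simp add: oriented_dimers_def)

lemma dimer_Z_cong:
  assumes "\<And>f. f \<in> aztec_faces k c \<Longrightarrow> a f = b f"
  shows "dimer_Z k c \<phi> a = dimer_Z k c \<phi> b"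
  unfolding dimer_Z_def
proof (intro sum.cong prod.cong refl)
  fix M e assume "M \<in> oriented_dimers k c" "e \<in> M"
  then have "e \<in> aztec_darts k c" using oriented_dimers_subset by blast
  from assms[OF right_face_in[OF this]] show "\<phi> e * a (right_face e) = \<phi> e * b (right_face e)" by simp
qed

lemma tendsto_dimer_Z:
  assumes "\<And>f. f \<in> aztec_faces k c \<Longrightarrow> ((\<lambda>x. a x f) \<longlongrightarrow> b f) F"
  shows "((\<lambda>x. dimer_Z k c \<phi> (a x)) \<longlongrightarrow> dimer_Z k c \<phi> b) F"
  unfolding dimer_Z_def
proof (intro tendsto_sum tendsto_prod tendsto_mult tendsto_const)
  fix M e assume "M \<in> oriented_dimers k c" "e \<in> M"
  then have "e \<in> aztec_darts k c" using oriented_dimers_subset by blast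
  from assms[OF right_face_in[OF this]] show "((\<lambda>x. a x (right_face e)) \<longlongrightarrow> b (right_face e)) F" .
qed

lemma dimer_Z_0: "dimer_Z 0 c \<phi> a = 1"
proof -
  have "aztec_darts 0 c = {}" "aztec_vertices 0 c = {}"
    by (cases c; auto simp: aztec_darts_def aztec_vertices_def internal_faces_def)+
  then show ?thesis by (simp add: dimer_Z_eq_matching_sum matching_sum_empty)
qed

text \<open>Sites are triples of even sum, so above each face exactly one of two consecutive levels
  carries a site. Raising \<open>t\<close> by 1 moves the sites at level t to t + 2 and keeps those
  at t + 1, which is the replacement made at the cells.\<close>

definition slice :: "(int \<Rightarrow> int \<Rightarrow> int \<Rightarrow> 'a) \<Rightarrow> int \<Rightarrow> face \<Rightarrow> 'a" where
  "slice P t f = P (fst f) (snd f) (if even (fst f + snd f + t) then t else t + 1)"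

text \<open>A triple of odd sum is the centre of an octahedron of sites; the equation ties its top
  to its bottom and its four sides. The homogeneous form makes sense for infinite points as
  well.\<close>

locale dskp_lattice =
  fixes P :: "int \<Rightarrow> int \<Rightarrow> int \<Rightarrow> complex \<times> complex"
  assumes nonzero: "even (i + j + t) \<Longrightarrow> P i j t \<noteq> (0, 0)"
    and distinct_neighbours: "odd (i + j + t) \<Longrightarrow>
      wedge (P (i+1) j t) (P i (j+1) t) \<noteq> 0 \<and> wedge (P i (j+1) t) (P (i-1) j t) \<noteq> 0 \<and>
      wedge (P (i-1) j t) (P i (j-1) t) \<noteq> 0 \<and> wedge (P i (j-1) t) (P (i+1) j t) \<noteq> 0"
    and dskp: "odd (i + j + t) \<Longrightarrow>
      wedge (P i j (t+1)) (dskp_vector (P i j (t-1)) (P (i+1) j t) (P i (j+1) t) (P (i-1) j t) (P i (j-1) t)) = 0"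
begin

text \<open>Each step lowers the size and raises the level by 1, so the apex at level t + k + 1
  stays fixed during the induction. The orientation is arbitrary because every step flips
  it.\<close>

lemma dimer_Z_generic_chart:
  assumes "even (u + v + t + int k + 1)" "kasteleyn_orientation k (u, v) \<phi>"
  shows "\<exists>C. \<forall>L M. wedge M L * wedge M L = 1 \<longrightarrow>
    (\<forall>i j s. \<bar>i - u\<bar> + \<bar>j - v\<bar> \<le> int k \<longrightarrow> t \<le> s \<longrightarrow> s \<le> t + int k + 1 \<longrightarrow> even (i + j + s) \<longrightarrow> wedge (P i j s) L \<noteq> 0) \<longrightarrow>
    (\<Prod>f\<in>aztec_faces k (u, v). wedge (slice P t f) L) * dimer_Z k (u, v) \<phi> (\<lambda>f. chart L M (slice P t f)) =
    C * wedge (P u v (t + int k + 1)) L"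
  using assms
proof (induction k arbitrary: t \<phi>)
  case 0
  \<comment> \<open>By parity the only face of the empty diamond has level t + 1, whence the extra 1
    in the level of the apex.\<close>
  have "aztec_faces 0 (u, v) = {(u, v)}" by (auto simp: aztec_faces_def)
  moreover have "slice P t (u, v) = P u v (t + 1)" using 0(1) by (simp add: slice_def)
  ultimately show ?case by (intro exI[of _ 1]) (simp add: dimer_Z_0)
next
  case (Suc k)
  let ?c = "(u, v)"
  let ?X = "slice P t" and ?X' = "slice P (t + 1)"
  have cell: "even (i + j + t)" if "(i, j) \<in> aztec_cells k ?c" for i j
    using that Suc.prems(1) unfolding aztec_cells_iff of_nat_Suc by presburger
  have noncell: "odd (i + j + t)" if "(i, j) \<in> aztec_faces (Suc k) ?c" "(i, j) \<notin> aztec_cells k ?c" for i j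
  proof
    assume "even (i + j + t)"
    then have e: "even (i + j + u + v + int k)" using Suc.prems(1) unfolding of_nat_Suc by presburger
    with cell_parity[OF e] that show False unfolding aztec_cells_iff aztec_faces_iff of_nat_Suc by linarith
  qed
  have X: "?X (i, j) = P i j t" "?X' (i, j) = P i j (t + 2)" "?X (i+1, j) = P (i+1) j (t + 1)"
    "?X (i, j+1) = P i (j+1) (t + 1)" "?X (i-1, j) = P (i-1) j (t + 1)" "?X (i, j-1) = P i (j-1) (t + 1)"
    "odd (i + j + (t + 1))"
    if "(i, j) \<in> aztec_cells k ?c" for i j
  proof -
    have e: "even (i + j + t) = True" "even (i + j + (t + 1)) = False" "even (i + 1 + j + t) = False"
      "even (i + (j + 1) + t) = False" "even (i - 1 + j + t) = False" "even (i + (j - 1) + t) = False"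
      using cell[OF that] by presburger+
    show "?X (i, j) = P i j t" "?X' (i, j) = P i j (t + 2)" "?X (i+1, j) = P (i+1) j (t + 1)"
      "?X (i, j+1) = P i (j+1) (t + 1)" "?X (i-1, j) = P (i-1) j (t + 1)" "?X (i, j-1) = P i (j-1) (t + 1)"
      "odd (i + j + (t + 1))"
      by (simp_all only: slice_def fst_conv snd_conv e if_True if_False not_False_eq_True)
        (simp only: add.assoc one_add_one)
  qed
  have "\<exists>C. \<forall>L M. wedge M L * wedge M L = 1 \<longrightarrow> (\<forall>f\<in>aztec_faces (Suc k) ?c. wedge (?X f) L \<noteq> 0) \<longrightarrow>
    (\<forall>f\<in>aztec_faces k ?c. wedge (?X' f) L \<noteq> 0) \<longrightarrow>
    (\<Prod>f\<in>aztec_faces (Suc k) ?c. wedge (?X f) L) * dimer_Z (Suc k) ?c \<phi> (\<lambda>f. chart L M (?X f)) =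
    C * ((\<Prod>f\<in>aztec_faces k ?c. wedge (?X' f) L) * dimer_Z k ?c (flip_vertical \<phi>) (\<lambda>f. chart L M (?X' f)))"
  proof (rule dimer_Z_homogeneous_step[OF Suc.prems(2)])
    fix f assume "f \<in> aztec_faces (Suc k) ?c" "f \<notin> aztec_cells k ?c"
    then show "?X' f = ?X f" using noncell[of "fst f" "snd f"] by (simp add: slice_def)
  next
    fix i j assume f: "(i, j) \<in> aztec_cells k ?c"
    show "wedge (?X' (i, j)) (dskp_vector (?X (i, j)) (?X (i+1, j)) (?X (i, j+1)) (?X (i-1, j)) (?X (i, j-1))) = 0"
      using dskp[OF X(7)[OF f]] unfolding X(1-6)[OF f] add_diff_cancel_right'
      by (simp only: add.assoc[of t] one_add_one)
    show "wedge (?X (i+1, j)) (?X (i, j+1)) \<noteq> 0 \<and> wedge (?X (i, j+1)) (?X (i-1, j)) \<noteq> 0 \<and>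
      wedge (?X (i-1, j)) (?X (i, j-1)) \<noteq> 0 \<and> wedge (?X (i, j-1)) (?X (i+1, j)) \<noteq> 0"
      unfolding X(1-6)[OF f] by (rule distinct_neighbours[OF X(7)[OF f]])
  next
    fix f assume "f \<in> aztec_cells k ?c"
    then show "?X' f \<noteq> (0, 0)"
      using X(2)[of "fst f" "snd f"] cell[of "fst f" "snd f"] nonzero[of "fst f" "snd f" "t + 2"] by simp
  qed
  then obtain C where C: "\<And>L M. wedge M L * wedge M L = 1 \<Longrightarrow> \<forall>f\<in>aztec_faces (Suc k) ?c. wedge (?X f) L \<noteq> 0 \<Longrightarrow>
    \<forall>f\<in>aztec_faces k ?c. wedge (?X' f) L \<noteq> 0 \<Longrightarrow>
    (\<Prod>f\<in>aztec_faces (Suc k) ?c. wedge (?X f) L) * dimer_Z (Suc k) ?c \<phi> (\<lambda>f. chart L M (?X f)) =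
    C * ((\<Prod>f\<in>aztec_faces k ?c. wedge (?X' f) L) * dimer_Z k ?c (flip_vertical \<phi>) (\<lambda>f. chart L M (?X' f)))"
    by metis
  have "even (u + v + (t + 1) + int k + 1)" using Suc.prems(1) by simp
  from Suc.IH[OF this kasteleyn_flip_vertical[OF Suc.prems(2)]]
  obtain D where D: "\<And>L M. wedge M L * wedge M L = 1 \<Longrightarrow>
    \<forall>i j s. \<bar>i - u\<bar> + \<bar>j - v\<bar> \<le> int k \<longrightarrow> t + 1 \<le> s \<longrightarrow> s \<le> t + 1 + int k + 1 \<longrightarrow> even (i + j + s) \<longrightarrow> wedge (P i j s) L \<noteq> 0 \<Longrightarrow>
    (\<Prod>f\<in>aztec_faces k ?c. wedge (?X' f) L) * dimer_Z k ?c (flip_vertical \<phi>) (\<lambda>f. chart L M (?X' f)) =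
    D * wedge (P u v (t + 1 + int k + 1)) L"
    by metis
  show ?case
  proof (intro exI[of _ "C * D"] allI impI)
    fix L M assume m: "wedge M L * wedge M L = 1"
      and gen: "\<forall>i j s. \<bar>i - u\<bar> + \<bar>j - v\<bar> \<le> int (Suc k) \<longrightarrow> t \<le> s \<longrightarrow> s \<le> t + int (Suc k) + 1 \<longrightarrow>
        even (i + j + s) \<longrightarrow> wedge (P i j s) L \<noteq> 0"
    have 1: "\<forall>f\<in>aztec_faces (Suc k) ?c. wedge (?X f) L \<noteq> 0"
    proof
      fix f assume f: "f \<in> aztec_faces (Suc k) ?c"
      show "wedge (?X f) L \<noteq> 0"
        unfolding slice_def using f by (intro gen[rule_format]) (cases f; simp)+
    qed
    have 2: "\<forall>f\<in>aztec_faces k ?c. wedge (?X' f) L \<noteq> 0"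
    proof
      fix f assume f: "f \<in> aztec_faces k ?c"
      show "wedge (?X' f) L \<noteq> 0"
        unfolding slice_def using f by (intro gen[rule_format]) (cases f; simp)+
    qed
    have 3: "\<forall>i j s. \<bar>i - u\<bar> + \<bar>j - v\<bar> \<le> int k \<longrightarrow> t + 1 \<le> s \<longrightarrow> s \<le> t + 1 + int k + 1 \<longrightarrow>
        even (i + j + s) \<longrightarrow> wedge (P i j s) L \<noteq> 0"
      by (intro allI impI gen[rule_format]) simp_all
    have top: "t + 1 + int k + 1 = t + int (Suc k) + 1" by simp
    show "(\<Prod>f\<in>aztec_faces (Suc k) ?c. wedge (?X f) L) * dimer_Z (Suc k) ?c \<phi> (\<lambda>f. chart L M (?X f)) =
        C * D * wedge (P u v (t + int (Suc k) + 1)) L"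
      unfolding C[OF m 1 2] D[OF m 3, unfolded top] by simp
  qed
qed

text \<open>At the end point \<open>L 0\<close> only the initial slice has to avoid the zeros of
  \<open>wedge p L\<close>. The points of later levels avoid them nearby, both sides are continuous
  at 0 along the curve, and \<open>C\<close> does not vary with it.\<close>

lemma dimer_Z_chart:
  assumes "even (u + v + t + int k + 1)" "kasteleyn_orientation k (u, v) \<phi>"
  obtains C where "\<And>M L. (\<And>\<epsilon>. wedge M (L \<epsilon>) * wedge M (L \<epsilon>) = 1) \<Longrightarrow>
    (\<And>p. (\<lambda>\<epsilon>. wedge p (L \<epsilon>)) \<midarrow>0\<rightarrow> wedge p (L 0)) \<Longrightarrow>
    (\<And>p. p \<noteq> (0, 0) \<Longrightarrow> eventually (\<lambda>\<epsilon>. wedge p (L \<epsilon>) \<noteq> 0) (at (0 :: complex))) \<Longrightarrow>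
    (\<And>f. f \<in> aztec_faces k (u, v) \<Longrightarrow> wedge (slice P t f) (L 0) \<noteq> 0) \<Longrightarrow>
    (\<Prod>f\<in>aztec_faces k (u, v). wedge (slice P t f) (L 0)) * dimer_Z k (u, v) \<phi> (\<lambda>f. chart (L 0) M (slice P t f)) =
    C * wedge (P u v (t + int k + 1)) (L 0)"
proof -
  from dimer_Z_generic_chart[OF assms] obtain C where C: "\<And>L M. wedge M L * wedge M L = 1 \<Longrightarrow>
    \<forall>i j s. \<bar>i - u\<bar> + \<bar>j - v\<bar> \<le> int k \<longrightarrow> t \<le> s \<longrightarrow> s \<le> t + int k + 1 \<longrightarrow> even (i + j + s) \<longrightarrow> wedge (P i j s) L \<noteq> 0 \<Longrightarrow>
    (\<Prod>f\<in>aztec_faces k (u, v). wedge (slice P t f) L) * dimer_Z k (u, v) \<phi> (\<lambda>f. chart L M (slice P t f)) =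
    C * wedge (P u v (t + int k + 1)) L"
    by metis
  show ?thesis
  proof (rule that[of C])
    fix M :: "complex \<times> complex" and L :: "complex \<Rightarrow> complex \<times> complex"
    assume m: "\<And>\<epsilon>. wedge M (L \<epsilon>) * wedge M (L \<epsilon>) = 1"
      and lim: "\<And>p. (\<lambda>\<epsilon>. wedge p (L \<epsilon>)) \<midarrow>0\<rightarrow> wedge p (L 0)"
      and gen: "\<And>p. p \<noteq> (0, 0) \<Longrightarrow> eventually (\<lambda>\<epsilon>. wedge p (L \<epsilon>) \<noteq> 0) (at (0 :: complex))"
      and init: "\<And>f. f \<in> aztec_faces k (u, v) \<Longrightarrow> wedge (slice P t f) (L 0) \<noteq> 0"
    have lim_M: "(\<lambda>\<epsilon>. chart (L \<epsilon>) M (slice P t f)) \<midarrow>0\<rightarrow> chart (L 0) M (slice P t f)"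
      if "f \<in> aztec_faces k (u, v)" for f
      unfolding chart_def by (intro tendsto_divide tendsto_const lim init[OF that])
    have lim_left: "(\<lambda>\<epsilon>. (\<Prod>f\<in>aztec_faces k (u, v). wedge (slice P t f) (L \<epsilon>)) *
          dimer_Z k (u, v) \<phi> (\<lambda>f. chart (L \<epsilon>) M (slice P t f))) \<midarrow>0\<rightarrow>
        (\<Prod>f\<in>aztec_faces k (u, v). wedge (slice P t f) (L 0)) * dimer_Z k (u, v) \<phi> (\<lambda>f. chart (L 0) M (slice P t f))"
      by (intro tendsto_mult tendsto_prod lim tendsto_dimer_Z lim_M)
    have lim_right: "(\<lambda>\<epsilon>. C * wedge (P u v (t + int k + 1)) (L \<epsilon>)) \<midarrow>0\<rightarrow> C * wedge (P u v (t + int k + 1)) (L 0)"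
      by (intro tendsto_mult tendsto_const lim)
    \<comment> \<open>A finite set containing all sites that the genericity condition mentions, so
      one punctured neighbourhood of 0 serves them all.\<close>
    let ?B = "{p \<in> aztec_faces k (u, v) \<times> {t..t + int k + 1}. even (fst (fst p) + snd (fst p) + snd p)}"
    have "finite ?B" by (simp add: finite_aztec_faces)
    then have "eventually (\<lambda>\<epsilon>. \<forall>p\<in>?B. wedge (P (fst (fst p)) (snd (fst p)) (snd p)) (L \<epsilon>) \<noteq> 0) (at 0)"
      by (rule eventually_ball_finite) (auto intro!: gen nonzero)
    then have "eventually (\<lambda>\<epsilon>. (\<Prod>f\<in>aztec_faces k (u, v). wedge (slice P t f) (L \<epsilon>)) *
          dimer_Z k (u, v) \<phi> (\<lambda>f. chart (L \<epsilon>) M (slice P t f)) =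
        C * wedge (P u v (t + int k + 1)) (L \<epsilon>)) (at 0)"
    proof (rule eventually_mono)
      fix \<epsilon> assume *: "\<forall>p\<in>?B. wedge (P (fst (fst p)) (snd (fst p)) (snd p)) (L \<epsilon>) \<noteq> 0"
      show "(\<Prod>f\<in>aztec_faces k (u, v). wedge (slice P t f) (L \<epsilon>)) *
          dimer_Z k (u, v) \<phi> (\<lambda>f. chart (L \<epsilon>) M (slice P t f)) = C * wedge (P u v (t + int k + 1)) (L \<epsilon>)"
      proof (rule C[OF m], intro allI impI)
        fix i j s assume "\<bar>i - u\<bar> + \<bar>j - v\<bar> \<le> int k" "t \<le> s" "s \<le> t + int k + 1" "even (i + j + s)"
        then have "((i, j), s) \<in> ?B" by simp
        from bspec[OF * this] show "wedge (P i j s) (L \<epsilon>) \<noteq> 0" by simp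
      qed
    qed
    from tendsto_unique[OF _ lim_left] lim_right tendsto_cong[OF this]
    show "(\<Prod>f\<in>aztec_faces k (u, v). wedge (slice P t f) (L 0)) *
          dimer_Z k (u, v) \<phi> (\<lambda>f. chart (L 0) M (slice P t f)) = C * wedge (P u v (t + int k + 1)) (L 0)"
      by simp
  qed
qed

theorem ratio_function_eq:
  fixes a :: "face \<Rightarrow> complex"
  assumes parity: "even (u + v + t + int k + 1)" and kast: "kasteleyn_orientation k (u, v) \<phi>"
    and a: "\<And>f. f \<in> aztec_faces k (u, v) \<Longrightarrow> slice P t f = (a f, 1) \<and> a f \<noteq> 0"
    and Z: "dimer_Z k (u, v) \<phi> a \<noteq> 0"
    and top: "P u v (t + int k + 1) = (y, 1)"
  shows "ratio_function k (u, v) \<phi> a = y"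
proof -
  obtain C where C: "\<And>M L. (\<And>\<epsilon>. wedge M (L \<epsilon>) * wedge M (L \<epsilon>) = 1) \<Longrightarrow>
    (\<And>p. (\<lambda>\<epsilon>. wedge p (L \<epsilon>)) \<midarrow>0\<rightarrow> wedge p (L 0)) \<Longrightarrow>
    (\<And>p. p \<noteq> (0, 0) \<Longrightarrow> eventually (\<lambda>\<epsilon>. wedge p (L \<epsilon>) \<noteq> 0) (at (0 :: complex))) \<Longrightarrow>
    (\<And>f. f \<in> aztec_faces k (u, v) \<Longrightarrow> wedge (slice P t f) (L 0) \<noteq> 0) \<Longrightarrow>
    (\<Prod>f\<in>aztec_faces k (u, v). wedge (slice P t f) (L 0)) * dimer_Z k (u, v) \<phi> (\<lambda>f. chart (L 0) M (slice P t f)) =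
    C * wedge (P u v (t + int k + 1)) (L 0)"
    using dimer_Z_chart[OF parity kast] by metis
  have lim: "(\<lambda>\<epsilon>::complex. c + d * \<epsilon>) \<midarrow>0\<rightarrow> c" for c d
    using tendsto_add[OF tendsto_const tendsto_mult[OF tendsto_const tendsto_ident_at], of c d 0 UNIV] by simp
  have gen: "eventually (\<lambda>\<epsilon>::complex. c + d * \<epsilon> \<noteq> 0) (at 0)" if "c \<noteq> 0 \<or> d \<noteq> 0" for c d
  proof (cases "c = 0")
    case True
    then show ?thesis using that by (auto simp: eventually_at intro: exI[of _ 1])
  next
    case False
    from tendsto_imp_eventually_ne[OF lim this] show ?thesis .
  qed
  have "(\<Prod>f\<in>aztec_faces k (u, v). wedge (slice P t f) (-1, 0)) *
      dimer_Z k (u, v) \<phi> (\<lambda>f. chart (-1, 0) (0, 1) (slice P t f)) = C * wedge (P u v (t + int k + 1)) (-1, 0)"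
  \<comment> \<open>Pairing with (-1, 0) gives the second coordinate, which is 1 on the weights, so
    the chart is \<open>a\<close>. The curve moves the pole of the chart away from infinity and
    keeps \<open>wedge M L\<close> equal to 1.\<close>
  proof (rule C[of "(0, 1)" "\<lambda>\<epsilon>. (-1, \<epsilon>)"])
    show "(\<lambda>\<epsilon>. wedge p (-1, \<epsilon>)) \<midarrow>0\<rightarrow> wedge p (-1, 0)" for p
      using lim[of "snd p" "fst p"] by (simp add: wedge_def add.commute)
    show "eventually (\<lambda>\<epsilon>. wedge p (-1, \<epsilon>) \<noteq> 0) (at 0)" if "p \<noteq> (0, 0)" for p
      using gen[of "snd p" "fst p"] that by (cases p) (auto simp: wedge_def add.commute)
  qed (simp_all add: wedge_def a)
  moreover have "dimer_Z k (u, v) \<phi> (\<lambda>f. chart (-1, 0) (0, 1) (slice P t f)) = dimer_Z k (u, v) \<phi> a"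
    by (rule dimer_Z_cong) (simp add: a chart_def wedge_def)
  ultimately have 1: "dimer_Z k (u, v) \<phi> a = C" by (simp add: a top wedge_def)
  have "(\<Prod>f\<in>aztec_faces k (u, v). wedge (slice P t f) (0, 1)) *
      dimer_Z k (u, v) \<phi> (\<lambda>f. chart (0, 1) (-1, 0) (slice P t f)) = C * wedge (P u v (t + int k + 1)) (0, 1)"
  \<comment> \<open>Here the pole is 0, moved to \<epsilon>, and the chart is the inverse of
    \<open>a\<close>. \<open>wedge M L\<close> is now -1, which is why only its square is
    prescribed.\<close>
  proof (rule C[of "(-1, 0)" "\<lambda>\<epsilon>. (\<epsilon>, 1)"])
    show "(\<lambda>\<epsilon>. wedge p (\<epsilon>, 1)) \<midarrow>0\<rightarrow> wedge p (0, 1)" for p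
      using lim[of "fst p" "- snd p"] by (simp add: wedge_def)
    show "eventually (\<lambda>\<epsilon>. wedge p (\<epsilon>, 1) \<noteq> 0) (at 0)" if "p \<noteq> (0, 0)" for p
      using gen[of "fst p" "- snd p"] that by (cases p) (auto simp: wedge_def)
  qed (simp_all add: wedge_def a)
  moreover have "dimer_Z k (u, v) \<phi> (\<lambda>f. chart (0, 1) (-1, 0) (slice P t f)) =
      dimer_Z k (u, v) \<phi> (\<lambda>f. inverse (a f))"
    by (rule dimer_Z_cong) (simp add: a chart_def wedge_def divide_inverse)
  ultimately have 2: "(\<Prod>f\<in>aztec_faces k (u, v). a f) * dimer_Z k (u, v) \<phi> (\<lambda>f. inverse (a f)) = C * y"
    by (simp add: a top wedge_def)
  show ?thesis using 1 2 Z by (simp add: ratio_function_def)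
qed

end

section \<open>Cross-ratio maps\<close>

lemma bracket_wedge: "bracket p q = wedge (homog p) (homog q)"
  by (simp add: bracket_def wedge_def)

lemma bracket_swap: "bracket q p = - bracket p q"
  by (simp add: bracket_def)

lemma bracket_eq_0_iff: "bracket p q = 0 \<longleftrightarrow> p = q"
  by (cases p; cases q) (auto simp: bracket_def)

lemma homog_nonzero: "homog p \<noteq> (0, 0)"
  by (cases p) auto

text \<open>Read backwards, the relations between \<open>z\<close> and \<open>w\<close> become
  relations between \<open>w\<close> and \<open>z\<close>: a Baecklund pair may be entered from
  either map.\<close>

lemma cross_ratio_rev: "cross_ratio d c b a = cross_ratio a b c d"
  unfolding cross_ratio_def
  using bracket_swap[of c b] bracket_swap[of a d] bracket_swap[of d c] bracket_swap[of b a]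
  by (simp add: mult.commute)

lemma cross_ratio_FinD:
  assumes "cross_ratio a b c d = Fin l"
  shows "bracket b c \<noteq> 0" "bracket d a \<noteq> 0" "bracket a b * bracket c d = l * (bracket b c * bracket d a)"
  using assms by (auto simp: cross_ratio_def split: if_splits)

text \<open>\<alpha>/\<beta> is the quotient of \<alpha>/\<gamma> and \<beta>/\<gamma>, so the
  labels cancel, and with them all brackets that contain \<open>v\<close>.\<close>

lemma multi_ratio:
  assumes v: "cross_ratio v v1 v12 v2 = Fin (\<alpha> / \<beta>)"
    and vu1: "cross_ratio v v1 u1 u = Fin (\<alpha> / \<gamma>)"
    and vu2: "cross_ratio v v2 u2 u = Fin (\<beta> / \<gamma>)"
    and nz: "\<alpha> \<noteq> 0" "\<beta> \<noteq> 0" "\<gamma> \<noteq> 0"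
  shows "bracket v12 v1 * bracket u u1 * bracket u2 v2 = - (bracket v12 v2 * bracket u u2 * bracket v1 u1)"
proof -
  note V = cross_ratio_FinD[OF v] and U1 = cross_ratio_FinD[OF vu1] and U2 = cross_ratio_FinD[OF vu2]
  have e: "bracket v v1 * bracket v12 v2 * \<beta> = \<alpha> * (bracket v1 v12 * bracket v2 v)"
    "bracket v v1 * bracket u1 u * \<gamma> = \<alpha> * (bracket v1 u1 * bracket u v)"
    "bracket v v2 * bracket u2 u * \<gamma> = \<beta> * (bracket v2 u2 * bracket u v)"
    using V(3) U1(3) U2(3) nz by (simp_all add: field_simps)
  have p: "bracket v v1 \<noteq> 0"
  proof
    assume "bracket v v1 = 0"
    with e(1) V(1,2) nz show False by simp
  qed
  note sw = bracket_swap[of v12 v1] bracket_swap[of u u1] bracket_swap[of u2 v2] bracket_swap[of u u2]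
    bracket_swap[of v v2]
  have "(bracket v v1 * \<beta> * bracket v2 v * \<gamma>) *
      (bracket v12 v1 * bracket u u1 * bracket u2 v2 + bracket v12 v2 * bracket u u2 * bracket v1 u1) = 0"
    using e unfolding sw by algebra
  then show ?thesis using p V(2) nz by (simp add: eq_neg_iff_add_eq_0)
qed

text \<open>The indices m, n solve m + n = s and m - n = p + q. The coordinate p - q only selects
  the map, modulo 4 and shifted by 2 for every two levels; at the levels 0 and 1 there is no shift
  and the selection is that of \<open>face_weight\<close>.\<close>

definition lattice_point ::
  "(int \<Rightarrow> int \<Rightarrow> riemann_sphere) \<Rightarrow> (int \<Rightarrow> int \<Rightarrow> riemann_sphere) \<Rightarrow> int \<Rightarrow> int \<Rightarrow> int \<Rightarrow> riemann_sphere" where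
  "lattice_point z w p q s =
     (if (p - q - 2 * (s div 2)) mod 4 \<in> {0, 3} then z else w) ((p + q + s) div 2) ((s - p - q) div 2)"

text \<open>An octahedron is the cube over a quad without two opposite vertices, here
  \<open>y' m n\<close> and \<open>y (m+1) (n+1)\<close>.\<close>

lemma lattice_point_octahedron:
  assumes "odd (i + j + t)"
  obtains m n y y' where "(y, y') = (z, w) \<or> (y, y') = (w, z)"
    "lattice_point z w i j (t - 1) = y m n" "lattice_point z w i j (t + 1) = y' (m + 1) (n + 1)"
    "lattice_point z w (i + 1) j t = y' (m + 1) n" "lattice_point z w i (j + 1) t = y (m + 1) n"
    "lattice_point z w (i - 1) j t = y m (n + 1)" "lattice_point z w i (j - 1) t = y' m (n + 1)"
proof -
  obtain m where m: "i + j + t = 2 * m + 1" using assms by (rule oddE)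
  define n where "n = m - i - j"
  have half: "a div 2 = b" if "a = 2 * b" for a b :: int using that by simp
  define T where "T \<longleftrightarrow> (i - j - 2 * ((t - 1) div 2)) mod 4 \<in> {0, 3}"
  have site: "(i + j + (t - 1)) div 2 = m" "(t - 1 - i - j) div 2 = n"
    "(i + j + (t + 1)) div 2 = m + 1" "(t + 1 - i - j) div 2 = n + 1"
    "(i + 1 + j + t) div 2 = m + 1" "(t - (i + 1) - j) div 2 = n"
    "(i + (j + 1) + t) div 2 = m + 1" "(t - i - (j + 1)) div 2 = n"
    "(i - 1 + j + t) div 2 = m" "(t - (i - 1) - j) div 2 = n + 1"
    "(i + (j - 1) + t) div 2 = m" "(t - i - (j - 1)) div 2 = n + 1"
    by (rule half, use m in \<open>simp add: n_def\<close>)+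
  have type: "((i - j - 2 * ((t + 1) div 2)) mod 4 \<in> {0, 3} \<longleftrightarrow> \<not> T) \<and>
    ((i + 1 - j - 2 * (t div 2)) mod 4 \<in> {0, 3} \<longleftrightarrow> \<not> T) \<and>
    ((i - (j + 1) - 2 * (t div 2)) mod 4 \<in> {0, 3} \<longleftrightarrow> T) \<and>
    ((i - 1 - j - 2 * (t div 2)) mod 4 \<in> {0, 3} \<longleftrightarrow> T) \<and>
    ((i - (j - 1) - 2 * (t div 2)) mod 4 \<in> {0, 3} \<longleftrightarrow> \<not> T)"
  proof -
    \<comment> \<open>For fixed parity of \<open>t\<close> all selections depend on \<open>e\<close>
      modulo 4, and the oddness of e + t leaves two residues.\<close>
    define e where "e = i - j - 2 * (t div 2)"
    have shift: "i + 1 - j - 2 * (t div 2) = e + 1" "i - (j + 1) - 2 * (t div 2) = e - 1"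
      "i - 1 - j - 2 * (t div 2) = e - 1" "i - (j - 1) - 2 * (t div 2) = e + 1"
      by (simp_all add: e_def)
    have "odd (e + t)" using assms by (simp add: e_def)
    have shift_mod: "(e + 1) mod 4 = (e mod 4 + 1) mod 4" "(e + 2) mod 4 = (e mod 4 + 2) mod 4"
      "(e - 1) mod 4 = (e mod 4 - 1) mod 4" "(e - 2) mod 4 = (e mod 4 - 2) mod 4"
      by (simp_all only: mod_add_left_eq mod_diff_left_eq)
    show ?thesis
    proof (cases "even t")
      case True
      then have "odd e" using \<open>odd (e + t)\<close> by simp
      then have residue: "e mod 4 = 1 \<or> e mod 4 = 3" by presburger
      have "(t + 1) div 2 = t div 2" "(t - 1) div 2 = t div 2 - 1" using True by presburger+
      then have halves: "i - j - 2 * ((t + 1) div 2) = e" "i - j - 2 * ((t - 1) div 2) = e + 2"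
        by (simp_all add: e_def)
      show ?thesis
        using residue by (elim disjE) (simp_all only: T_def shift halves shift_mod, simp_all)
    next
      case False
      then have "even e" using \<open>odd (e + t)\<close> by simp
      then have residue: "e mod 4 = 0 \<or> e mod 4 = 2" by presburger
      have "(t + 1) div 2 = t div 2 + 1" "(t - 1) div 2 = t div 2" using False by presburger+
      then have halves: "i - j - 2 * ((t + 1) div 2) = e - 2" "i - j - 2 * ((t - 1) div 2) = e"
        by (simp_all add: e_def)
      show ?thesis
        using residue by (elim disjE) (simp_all only: T_def shift halves shift_mod, simp_all)
    qed
  qed
  note type = type[THEN conjunct1] type[THEN conjunct2, THEN conjunct1]
    type[THEN conjunct2, THEN conjunct2, THEN conjunct1]
    type[THEN conjunct2, THEN conjunct2, THEN conjunct2, THEN conjunct1]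
    type[THEN conjunct2, THEN conjunct2, THEN conjunct2, THEN conjunct2]
  show ?thesis
    by (rule that[of "if T then z else w" "if T then w else z" m n])
      (simp_all only: lattice_point_def site type T_def[symmetric] not_not if_True if_False split: if_split, simp_all)
qed

lemma dskp_lattice_baecklund:
  assumes pair: "baecklund_pair z w"
    and gen_z: "\<And>m n. z (m+1) n \<noteq> z m (n+1)" and gen_w: "\<And>m n. w (m+1) n \<noteq> w m (n+1)"
  shows "dskp_lattice (\<lambda>i j t. homog (lattice_point z w i j t))"
proof
  obtain \<alpha> \<beta> \<gamma> where nz: "\<And>i. \<alpha> i \<noteq> 0" "\<And>j. \<beta> j \<noteq> 0" "\<gamma> \<noteq> 0"
    and z: "\<And>i j. cross_ratio (z i j) (z (i+1) j) (z (i+1) (j+1)) (z i (j+1)) = Fin (\<alpha> i / \<beta> j)"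
    and w: "\<And>i j. cross_ratio (w i j) (w (i+1) j) (w (i+1) (j+1)) (w i (j+1)) = Fin (\<alpha> i / \<beta> j)"
    and zw1: "\<And>i j. cross_ratio (z i j) (z (i+1) j) (w (i+1) j) (w i j) = Fin (\<alpha> i / \<gamma>)"
    and zw2: "\<And>i j. cross_ratio (z i j) (z i (j+1)) (w i (j+1)) (w i j) = Fin (\<beta> j / \<gamma>)"
    using pair unfolding baecklund_pair_def integrable_cross_ratio_map_def by metis
  show "homog (lattice_point z w i j t) \<noteq> (0, 0)" for i j t by (rule homog_nonzero)
  have zw: "z m n \<noteq> w m n" for m n
    using cross_ratio_FinD(2)[OF zw1[of m n]] unfolding bracket_eq_0_iff by metis
  fix i j t :: int assume "odd (i + j + t)"
  then obtain m n y y' where y: "(y, y') = (z, w) \<or> (y, y') = (w, z)"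
    and pts: "lattice_point z w i j (t - 1) = y m n" "lattice_point z w i j (t + 1) = y' (m + 1) (n + 1)"
    "lattice_point z w (i + 1) j t = y' (m + 1) n" "lattice_point z w i (j + 1) t = y (m + 1) n"
    "lattice_point z w (i - 1) j t = y m (n + 1)" "lattice_point z w i (j - 1) t = y' m (n + 1)"
    by (rule lattice_point_octahedron)
  \<comment> \<open>Two of these pairs are corresponding points of the two maps, distinct because
    the cross-ratios are defined. The other two are diagonals of quads, the subject of
    \<open>gen_z\<close> and \<open>gen_w\<close>.\<close>
  have "y' (m + 1) n \<noteq> y (m + 1) n" "y (m + 1) n \<noteq> y m (n + 1)" "y m (n + 1) \<noteq> y' m (n + 1)"
    "y' m (n + 1) \<noteq> y' (m + 1) n"
    using y zw[of "m+1" n] zw[of m "n+1"] gen_z[of m n] gen_w[of m n] by auto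
  then show "wedge (homog (lattice_point z w (i+1) j t)) (homog (lattice_point z w i (j+1) t)) \<noteq> 0 \<and>
      wedge (homog (lattice_point z w i (j+1) t)) (homog (lattice_point z w (i-1) j t)) \<noteq> 0 \<and>
      wedge (homog (lattice_point z w (i-1) j t)) (homog (lattice_point z w i (j-1) t)) \<noteq> 0 \<and>
      wedge (homog (lattice_point z w i (j-1) t)) (homog (lattice_point z w (i+1) j t)) \<noteq> 0"
    unfolding pts bracket_wedge[symmetric] bracket_eq_0_iff by blast
  \<comment> \<open>The eliminated vertex is \<open>y' m n\<close>. If it belongs to
    \<open>w\<close>, the cross-ratios between the maps are read backwards.\<close>
  have "bracket (y' (m+1) (n+1)) (y' (m+1) n) * bracket (y m n) (y (m+1) n) * bracket (y m (n+1)) (y' m (n+1)) =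
    - (bracket (y' (m+1) (n+1)) (y' m (n+1)) * bracket (y m n) (y m (n+1)) * bracket (y' (m+1) n) (y (m+1) n))"
    using y
  proof
    assume "(y, y') = (z, w)"
    then have "y = z" "y' = w" by simp_all
    then show ?thesis
      using multi_ratio[OF w trans[OF cross_ratio_rev zw1] trans[OF cross_ratio_rev zw2] nz(1,2,3), of m n] by simp
  next
    assume "(y, y') = (w, z)"
    then have "y = w" "y' = z" by simp_all
    then show ?thesis using multi_ratio[OF z zw1 zw2 nz(1,2,3), of m n] by simp
  qed
  then show "wedge (homog (lattice_point z w i j (t+1)))
      (dskp_vector (homog (lattice_point z w i j (t-1))) (homog (lattice_point z w (i+1) j t))
        (homog (lattice_point z w i (j+1) t)) (homog (lattice_point z w (i-1) j t))
        (homog (lattice_point z w i (j-1) t))) = 0"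
    unfolding pts bracket_wedge wedge_swap[of "homog (y' (m+1) (n+1))" "dskp_vector _ _ _ _ _"] wedge_dskp_vector
    using wedge_swap[of "homog (y' (m+1) n)" "homog (y' (m+1) (n+1))"]
      wedge_swap[of "homog (y' m (n+1))" "homog (y' (m+1) (n+1))"]
    by algebra
qed

text \<open>Genericity is spelled out: finite and nonzero weights on the faces of the diamond, a
  nonzero denominator of the ratio function, and distinct points on the diagonals of
  \<open>w\<close>. For \<open>z\<close> the last property comes from recutting.\<close>

theorem corollary7p3:
  fixes z w :: "int \<Rightarrow> int \<Rightarrow> riemann_sphere"
    and i j u v :: int
    and \<phi> :: "dart \<Rightarrow> complex"
    and a :: "face \<Rightarrow> complex"
  assumes recutting: "polygon_recutting_lattice_map z"
    and pair: "baecklund_pair z w"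
    and generic_w: "\<And>m n. w (m+1) n \<noteq> w m (n+1)"
    and level: "i + j \<ge> 1"
    and centre: "u + v = i - j"
    and centre_z: "(i + j) mod 4 \<in> {0, 1} \<Longrightarrow> (u - v) mod 4 \<in> {0, 3}"
    and centre_w: "(i + j) mod 4 \<in> {2, 3} \<Longrightarrow> (u - v) mod 4 \<in> {1, 2}"
    and orientation: "kasteleyn_orientation (nat (i + j - 1)) (u, v) \<phi>"
    and weights: "\<And>f. f \<in> aztec_faces (nat (i + j - 1)) (u, v) \<Longrightarrow> face_weight z w f = Fin (a f)"
    and generic_weights: "\<And>f. f \<in> aztec_faces (nat (i + j - 1)) (u, v) \<Longrightarrow> a f \<noteq> 0"
    and generic_Z: "dimer_Z (nat (i + j - 1)) (u, v) \<phi> a \<noteq> 0"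
  shows "z i j = Fin (ratio_function (nat (i + j - 1)) (u, v) \<phi> a)"
proof -
  obtain t where t: "polygon_recutting t" "\<And>i j. z i j = Fin (t (i-j) (i+j))"
    using recutting unfolding polygon_recutting_lattice_map_def by blast
  \<comment> \<open>These two points are the ends of a segment whose bisector serves as a mirror in
    the recutting, hence distinct.\<close>
  have generic_z: "z (m+1) n \<noteq> z m (n+1)" for m n
  proof -
    have "even ((m - n) + (m + n + 2))" by presburger
    then have "t (m - n - 1) (m + n + 2 - 1) \<noteq> t (m - n + 1) (m + n + 2 - 1)"
      using t(1) unfolding polygon_recutting_def by blast
    then show ?thesis by (simp add: t(2) algebra_simps)
  qed
  let ?P = "\<lambda>i j t. homog (lattice_point z w i j t)"
  let ?k = "nat (i + j - 1)"
  interpret dskp_lattice ?P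
    using pair generic_z generic_w by (rule dskp_lattice_baecklund[of z w])
  have top: "0 + int ?k + 1 = i + j" using level by simp
  \<comment> \<open>Over the face (p, q) the site of the initial slice has level (p + q) mod 2; this
    is the correction term in \<open>face_weight\<close>.\<close>
  have initial: "slice ?P 0 f = homog (face_weight z w f)" for f
  proof -
    obtain p q where f: "f = (p, q)" by fastforce
    have "slice ?P 0 f = ?P p q ((p + q) mod 2)"
      by (simp add: slice_def f mod2_eq_if)
    also have "(p + q) mod 2 div 2 = 0" by simp
    then have "?P p q ((p + q) mod 2) = homog (face_weight z w f)"
      by (simp add: lattice_point_def f algebra_simps)
    finally show ?thesis .
  qed
  have "lattice_point z w u v (i + j) = z i j"
  proof -
    have sites: "(u + v + (i + j)) div 2 = i" "(i + j - u - v) div 2 = j" using centre by presburger+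
    define q where "q = (i + j) div 2"
    \<comment> \<open>The selection at level i + j is shifted by 2q, and modulo 4 only the parity of
      q matters. It is the upper binary digit of (i + j) mod 4, which yields the two cases for the
      centre.\<close>
    have mod4: "(i + j) mod 4 = 2 * (q mod 2) + (i + j) mod 2"
      unfolding q_def using mod_mult2_eq'[of "i + j" 2 2] by simp
    have "(u - v - 2 * q) mod 4 \<in> {0, 3}"
    proof (cases "even q")
      case True
      then have "(i + j) mod 4 \<in> {0, 1}" unfolding mod4 by (simp add: mod2_eq_if)
      moreover have "(x - 2 * q) mod 4 = x mod 4" for x using True by presburger
      ultimately show ?thesis using centre_z by simp
    next
      case False
      then have "(i + j) mod 4 \<in> {2, 3}" unfolding mod4 by (simp add: mod2_eq_if)
      moreover have "(x - 2 * q) mod 4 = (x + 2) mod 4" for x using False by presburger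
      moreover have "(x + 2) mod 4 \<in> {0, 3}" if "x mod 4 \<in> {1, 2}" for x :: int
        using that unfolding insert_iff empty_iff by presburger
      ultimately show ?thesis using centre_w by simp
    qed
    then show ?thesis by (simp add: lattice_point_def sites q_def)
  qed
  then have "?P u v (0 + int ?k + 1) = (t (i - j) (i + j), 1)"
    unfolding top by (simp add: t(2))
  moreover have "even (u + v + 0 + int ?k + 1)"
  proof -
    have "u + v + 0 + int ?k + 1 = 2 * i" using top centre by linarith
    then show ?thesis by simp
  qed
  moreover have "slice ?P 0 f = (a f, 1) \<and> a f \<noteq> 0" if "f \<in> aztec_faces ?k (u, v)" for f
    using weights[OF that] generic_weights[OF that] by (simp add: initial)
  ultimately have "ratio_function ?k (u, v) \<phi> a = t (i - j) (i + j)"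
    using orientation generic_Z by (intro ratio_function_eq[where t = 0]) simp_all
  then show ?thesis by (simp add: t(2))
qed

end
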